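(* Let $T=\{(\pm1,0,0),(0,\pm1,0),(0,0,\pm1)\}\subseteq \mathbb{H}(\mathbb{Z})$ and let $G=\mathrm{Cay}(\mathbb{H}(\mathbb{Z}),T)$ be the Cayley graph of the discrete Heisenberg group with respect to $T$. Then the growth function of $G$ satisfies $f_G(r)\le 27\cdot r^4$ for every $r\in\mathbb{N}$, and, for every $C\in\mathbb{N}$ and every quadruple of finite or countably infinite trees $F_1,F_2,F_3,F_4$ satisfying $f_{F_i}(r)\le Cr$ for all $r\in\mathbb{N}$ and all $i\in\{1,2,3,4\}$, no subgraph of $F_1\boxtimes F_2\boxtimes F_3\boxtimes F_4\boxtimes K_C$ is isomorphic to $G$.
   Context: $\mathbb{N}$ denotes the positive integers. The discrete Heisenberg group $\mathbb{H}(\mathbb{Z})$ is $\mathbb{Z}^3$ with the product $(a,b,c)\cdot(a',b',c')=(a+a',b+b',c+c'+ab'-ba')$ and identity $(0,0,0)$; the set $T$ generates it. The graph $\mathrm{Cay}(\mathbb{H}(\mathbb{Z}),T)$ has vertex set $\mathbb{Z}^3$, and the six neighbours of $(a,b,c)$ are $(a,b,c)\cdot(\pm1,0,0)=(a\pm1,b,c\mp b)$, $(a,b,c)\cdot(0,\pm1,0)=(a,b\pm1,c\pm a)$ and $(a,b,c)\cdot(0,0,\pm1)=(a,b,c\pm1)$. For a (possibly infinite) graph $G$, the growth function $f_G:\mathbb{N}\to\mathbb{N}\cup\{\infty\}$ assigns to $r$ the supremum, over all vertices $v$ of $G$, of the number of vertices at graph distance at most $r$ from $v$. A tree is a (possibly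 infinite) connected graph without finite cycles. The strong product $H_1\boxtimes H_2$ of two graphs has vertex set $V(H_1)\times V(H_2)$, and two distinct vertices $(u_1,u_2),(v_1,v_2)$ are adjacent if and only if for both $i\in\{1,2\}$ we have $u_i=v_i$ or $u_iv_i\in E(H_i)$; products of several graphs are obtained by iterating. $K_C$ is the complete graph on $C$ vertices. Subgraphs need not be induced. *)

theory Defs
  imports "HOL-Library.Extended_Nat" "HOL-Library.Countable_Set" "HOL-Algebra.Group"
begin

section \<open>Graphs\<close>

text \<open>Edges are unordered pairs of distinct vertices; the vertex set may be infinite.\<close>

record 'a graph =
  vertices :: "'a set"
  edges :: "'a set set"

definition simple_graph :: "'a graph \<Rightarrow> bool" where
  "simple_graph G \<longleftrightarrow>
    edges G \<subseteq> {{u, v} | u v. u \<in> vertices G \<and> v \<in> vertices G \<and> u \<noteq> v}"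

definition adjacent :: "'a graph \<Rightarrow> 'a \<Rightarrow> 'a \<Rightarrow> bool" where
  "adjacent G u v \<longleftrightarrow> {u, v} \<in> edges G"

definition walk :: "'a graph \<Rightarrow> 'a list \<Rightarrow> bool" where
  "walk G p \<longleftrightarrow> p \<noteq> [] \<and> set p \<subseteq> vertices G \<and> successively (adjacent G) p"

definition connected_graph :: "'a graph \<Rightarrow> bool" where
  "connected_graph G \<longleftrightarrow> vertices G \<noteq> {} \<and>
    (\<forall>u \<in> vertices G. \<forall>v \<in> vertices G. \<exists>p. walk G p \<and> hd p = u \<and> last p = v)"

text \<open>A cycle is listed without repeating its starting vertex.\<close>

definition cycle :: "'a graph \<Rightarrow> 'a list \<Rightarrow> bool" where
  "cycle G p \<longleftrightarrow> 3 \<le> length p \<and> distinct p \<and> walk G p \<and> adjacent G (last p) (hd p)"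

definition tree :: "'a graph \<Rightarrow> bool" where
  "tree G \<longleftrightarrow> simple_graph G \<and> connected_graph G \<and> (\<nexists>p. cycle G p)"

definition subgraph :: "'a graph \<Rightarrow> 'a graph \<Rightarrow> bool" where
  "subgraph H G \<longleftrightarrow> simple_graph H \<and> vertices H \<subseteq> vertices G \<and> edges H \<subseteq> edges G"

definition isomorphic_graphs :: "'a graph \<Rightarrow> 'b graph \<Rightarrow> bool" where
  "isomorphic_graphs G H \<longleftrightarrow> (\<exists>f. bij_betw f (vertices G) (vertices H) \<and>
    (\<forall>u \<in> vertices G. \<forall>v \<in> vertices G. adjacent G u v \<longleftrightarrow> adjacent H (f u) (f v)))"

definition complete_graph :: "nat \<Rightarrow> nat graph" where
  "complete_graph n = \<lparr>vertices = {..<n}, edges = {{i, j} | i j. i < n \<and> j < n \<and> i \<noteq> j}\<rparr>"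

definition strong_product :: "'a graph \<Rightarrow> 'b graph \<Rightarrow> ('a \<times> 'b) graph"
    (infixl \<open>\<times>\<^sub>s\<close> 70) where
  "G \<times>\<^sub>s H = \<lparr>vertices = vertices G \<times> vertices H,
    edges = {{(u1, u2), (v1, v2)} | u1 u2 v1 v2.
      (u1, u2) \<in> vertices G \<times> vertices H \<and> (v1, v2) \<in> vertices G \<times> vertices H \<and>
      (u1, u2) \<noteq> (v1, v2) \<and> (u1 = v1 \<or> adjacent G u1 v1) \<and> (u2 = v2 \<or> adjacent H u2 v2)}\<rparr>"

section \<open>Growth\<close>

text \<open>The infimum over the empty set is \<open>\<infinity>\<close>, so vertices in different components are at
  distance \<open>\<infinity>\<close>.\<close>

definition graph_dist :: "'a graph \<Rightarrow> 'a \<Rightarrow> 'a \<Rightarrow> enat" where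
  "graph_dist G u v = (INF p \<in> {p. walk G p \<and> hd p = u \<and> last p = v}. enat (length p - 1))"

definition graph_ball :: "'a graph \<Rightarrow> 'a \<Rightarrow> nat \<Rightarrow> 'a set" where
  "graph_ball G v r = {w \<in> vertices G. graph_dist G v w \<le> enat r}"

definition ecard :: "'a set \<Rightarrow> enat" where
  "ecard A = (if finite A then enat (card A) else \<infinity>)"

text \<open>The growth function is meant for radii \<open>r \<ge> 1\<close> only.\<close>

definition growth :: "'a graph \<Rightarrow> nat \<Rightarrow> enat" where
  "growth G r = (SUP v \<in> vertices G. ecard (graph_ball G v r))"

section \<open>The discrete Heisenberg group and its Cayley graph\<close>

text \<open>Cayley graphs are with respect to right multiplication by the elements of \<open>S\<close>.\<close>

definition cayley_graph :: "('a, 'b) monoid_scheme \<Rightarrow> 'a set \<Rightarrow> 'a graph" where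
  "cayley_graph M S = \<lparr>vertices = carrier M,
    edges = {{x, x \<otimes>\<^bsub>M\<^esub> s} | x s. x \<in> carrier M \<and> s \<in> S \<and> x \<otimes>\<^bsub>M\<^esub> s \<noteq> x}\<rparr>"

definition heisenberg :: "(int \<times> int \<times> int) monoid" where
  "heisenberg = \<lparr>carrier = UNIV,
    mult = (\<lambda>(a, b, c) (a', b', c'). (a + a', b + b', c + c' + a * b' - b * a')),
    one = (0, 0, 0)\<rparr>"

definition heisenberg_gens :: "(int \<times> int \<times> int) set" where
  "heisenberg_gens = {(1, 0, 0), (-1, 0, 0), (0, 1, 0), (0, -1, 0), (0, 0, 1), (0, 0, -1)}"

lemma carrier_heisenberg: "carrier heisenberg = UNIV"
  by (simp add: heisenberg_def)

lemma one_heisenberg: "\<one>\<^bsub>heisenberg\<^esub> = (0, 0, 0)"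
  by (simp add: heisenberg_def)

lemma mult_heisenberg:
  "(a, b, c) \<otimes>\<^bsub>heisenberg\<^esub> (a', b', c') = (a + a', b + b', c + c' + a * b' - b * a')"
  by (simp add: heisenberg_def)

lemma group_heisenberg: "group heisenberg"
proof (rule groupI)
  fix x y z :: "int \<times> int \<times> int"
  show "x \<otimes>\<^bsub>heisenberg\<^esub> y \<otimes>\<^bsub>heisenberg\<^esub> z = x \<otimes>\<^bsub>heisenberg\<^esub> (y \<otimes>\<^bsub>heisenberg\<^esub> z)"
    by (cases x; cases y; cases z) (simp add: mult_heisenberg distrib_left distrib_right)
next
  fix x :: "int \<times> int \<times> int"
  show "\<one>\<^bsub>heisenberg\<^esub> \<otimes>\<^bsub>heisenberg\<^esub> x = x"
    by (cases x) (simp add: mult_heisenberg one_heisenberg)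
next
  fix x :: "int \<times> int \<times> int"
  obtain a b c where x: "x = (a, b, c)" by (cases x)
  have "(- a, - b, - c) \<otimes>\<^bsub>heisenberg\<^esub> x = \<one>\<^bsub>heisenberg\<^esub>"
    by (simp add: x mult_heisenberg one_heisenberg)
  then show "\<exists>y \<in> carrier heisenberg. y \<otimes>\<^bsub>heisenberg\<^esub> x = \<one>\<^bsub>heisenberg\<^esub>"
    unfolding carrier_heisenberg by blast
qed (simp_all only: carrier_heisenberg UNIV_I)

lemma adjacent_heisenberg:
  "adjacent (cayley_graph heisenberg heisenberg_gens) (a, b, c) v \<longleftrightarrow>
    v \<in> {(a + 1, b, c - b), (a - 1, b, c + b), (a, b + 1, c + a), (a, b - 1, c - a),
         (a, b, c + 1), (a, b, c - 1)}"
proof -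
  let ?M = heisenberg and ?S = heisenberg_gens and ?x = "(a, b, c)"
  have ne: "x \<otimes>\<^bsub>?M\<^esub> s \<noteq> x" if "s \<in> ?S" for x s
    using that by (cases x) (auto simp: mult_heisenberg heisenberg_gens_def)
  have inv: "\<exists>t \<in> ?S. x = (x \<otimes>\<^bsub>?M\<^esub> s) \<otimes>\<^bsub>?M\<^esub> t" if "s \<in> ?S" for x s
    using that by (cases x) (auto simp: mult_heisenberg heisenberg_gens_def)
  have "adjacent (cayley_graph ?M ?S) ?x v \<longleftrightarrow> (\<exists>y. \<exists>s \<in> ?S. {?x, v} = {y, y \<otimes>\<^bsub>?M\<^esub> s})"
    unfolding adjacent_def cayley_graph_def carrier_heisenberg graph.simps mem_Collect_eq
    using ne by blast
  also have "\<dots> \<longleftrightarrow> (\<exists>s \<in> ?S. v = ?x \<otimes>\<^bsub>?M\<^esub> s)"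
  proof
    assume "\<exists>y. \<exists>s \<in> ?S. {?x, v} = {y, y \<otimes>\<^bsub>?M\<^esub> s}"
    then obtain y s where s: "s \<in> ?S" and "{?x, v} = {y, y \<otimes>\<^bsub>?M\<^esub> s}" by blast
    then have "?x = y \<and> v = y \<otimes>\<^bsub>?M\<^esub> s \<or> ?x = y \<otimes>\<^bsub>?M\<^esub> s \<and> v = y"
      by (simp only: doubleton_eq_iff)
    then show "\<exists>s \<in> ?S. v = ?x \<otimes>\<^bsub>?M\<^esub> s"
    proof
      assume "?x = y \<otimes>\<^bsub>?M\<^esub> s \<and> v = y"
      then show ?thesis using inv[OF s, of y] by simp
    qed (use s in blast)
  qed blast
  also have "\<dots> \<longleftrightarrow> v \<in> {(a + 1, b, c - b), (a - 1, b, c + b), (a, b + 1, c + a),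
      (a, b - 1, c - a), (a, b, c + 1), (a, b, c - 1)}"
    by (simp add: mult_heisenberg heisenberg_gens_def)
  finally show ?thesis .
qed

end

theory Submission
  imports Defs "HOL-Real_Asymp.Real_Asymp" "HOL-Analysis.Convex"
begin

text \<open>
  The growth bound holds because the ball of radius \<open>r\<close> around \<open>v\<close> lies in \<open>v\<close> times the box
  \<open>|a| \<le> r, |b| \<le> r, |c| \<le> r\<^sup>2\<close>: boxes multiply like balls (lemma \<open>box_mult\<close>).

  An embedding of the Cayley graph into the product gives four 1-Lipschitz maps to the trees which,
  together with a colour below \<open>C\<close>, are jointly injective. The point is that maps to trees cannot see
  the centre of the group well. At some scale \<open>m\<close> and some base point \<open>x\<close>, all four maps send the
  points \<open>x z\<^bsup>2 m\<^sup>2 j\<^esup>\<close>, \<open>j \<le> J\<close>, where \<open>z = (0, 0, 1)\<close>, to within \<open>O(m)\<close> of the image of \<open>x\<close>,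
  although \<open>J\<close> may be chosen as large as desired (lemma \<open>collapsing_scale\<close>). Multiplying these
  points by a box of radius \<open>m\<close> gives at least \<open>J m\<^sup>4\<close> points which are mapped into a product of four balls of radius \<open>16 m\<close>, hence into at most
  \<open>C (16 C m)\<^sup>4\<close> points. For \<open>J > 16\<^sup>4 C\<^sup>5\<close> this contradicts injectivity
  (lemma \<open>no_injection_into_four_trees\<close>).

  The collapse is a coarse differentiation argument in two steps.

  First, average over a huge box the squared displacement \<open>(d(f x, f (x s\<^sup>n)) / n)\<^sup>2\<close> for a generator
  \<open>s\<close> and \<open>n = R\<^sup>k\<close>. By the triangle and Cauchy-Schwarz inequalities this average does not increase
  with \<open>k\<close>, up to a boundary error, and it lies between 0 and 1, so for some \<open>k\<close> it hardly drops. Near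
  equality in Cauchy-Schwarz and in the triangle inequality means that the images of nearly all
  lines at that scale are nearly geodesics of constant speed. As only boundedly many lines at the
  scale \<open>m = R\<^sup>k\<close> matter, some base point has all of them nearly uniform, for both horizontal
  generators and all four maps at once (lemmas \<open>small_drop_somewhere\<close>, \<open>small_defect_uniform\<close>).

  Second, rescale by \<open>m\<close>. Two parallel lines of half-length \<open>s\<^sup>2\<close> at bounded distance have endpoints at
  distance \<open>O(s)\<close>. If the lines in one horizontal direction have speed well above \<open>1 / s\<close>, then in a tree they must
  share their middle parts with one fixed geodesic, so that near the base point the map is
  essentially real-valued (lemma \<open>fast_line_gives_coordinate\<close>). A real-valued map that is nearly affine
  along both kinds of horizontal lines has nearly constant slopes, again because parallel lines
  diverge sublinearly, and then the commutator relation forces it to be nearly constant along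
  the centre (lemma \<open>central_step\<close>). If both speeds are \<open>O(1 / s)\<close>, the map moves little in every
  direction, and the centre collapses for this simpler reason.
\<close>

section \<open>The Heisenberg group and its boxes\<close>

type_synonym hpoint = "int \<times> int \<times> int"

abbreviation hmult :: "hpoint \<Rightarrow> hpoint \<Rightarrow> hpoint" (infixl \<open>\<odot>\<close> 70) where
  "x \<odot> y \<equiv> x \<otimes>\<^bsub>heisenberg\<^esub> y"

lemma hmult_assoc: "x \<odot> y \<odot> z = x \<odot> (y \<odot> z)"
  using group.is_monoid[OF group_heisenberg] by (simp add: monoid.m_assoc carrier_heisenberg)

lemma hmult_right_cancel: "x \<odot> g = y \<odot> g \<longleftrightarrow> x = y"
  by (cases x; cases y; cases g) (auto simp: mult_heisenberg)

lemma hmult_left_cancel: "g \<odot> x = g \<odot> y \<longleftrightarrow> x = y"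
  by (cases x; cases y; cases g) (auto simp: mult_heisenberg)

text \<open>Boxes replace balls in the word metric: they are comparable to balls, but their size is
  explicit and the dilations used below scale their radius.\<close>

definition box :: "nat \<Rightarrow> hpoint set" where
  "box r = {(a, b, c). \<bar>a\<bar> \<le> int r \<and> \<bar>b\<bar> \<le> int r \<and> \<bar>c\<bar> \<le> int (r ^ 2)}"

lemma box_eq_Times:
  "box r = {- int r..int r} \<times> {- int r..int r} \<times> {- int (r ^ 2)..int (r ^ 2)}"
  by (auto simp: box_def)

lemma finite_box: "finite (box r)"
  by (simp add: box_eq_Times)

lemma card_box: "card (box r) = (2 * r + 1) ^ 2 * (2 * r ^ 2 + 1)"
proof -
  have "card {- int n..int n} = 2 * n + 1" for n by simp
  then show ?thesis
    by (simp only: box_eq_Times card_cartesian_product power2_eq_square mult.assoc)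
qed

lemma one_in_box: "(0, 0, 0) \<in> box r"
  by (simp add: box_def)

lemma box_mono: "r \<le> s \<Longrightarrow> box r \<subseteq> box s"
proof -
  assume "r \<le> s"
  then have "r ^ 2 \<le> s ^ 2" by (simp add: power_mono)
  then have "int (r ^ 2) \<le> int (s ^ 2)" by (simp only: of_nat_le_iff)
  with \<open>r \<le> s\<close> show ?thesis unfolding box_eq_Times by (intro Sigma_mono) auto
qed

text \<open>The commutator term \<open>a b' - b a'\<close> contributes at most \<open>2 r s\<close>, which
  is the cross term of \<open>(r + s)\<^sup>2\<close>.\<close>

lemma box_mult:
  assumes "x \<in> box r" "y \<in> box s"
  shows "x \<odot> y \<in> box (r + s)"
proof -
  obtain a b c where x: "x = (a, b, c)" by (cases x)
  obtain a' b' c' where y: "y = (a', b', c')" by (cases y)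
  have b1: "\<bar>a\<bar> \<le> int r" "\<bar>b\<bar> \<le> int r" "\<bar>c\<bar> \<le> int r ^ 2"
    and b2: "\<bar>a'\<bar> \<le> int s" "\<bar>b'\<bar> \<le> int s" "\<bar>c'\<bar> \<le> int s ^ 2"
    using assms by (auto simp: x y box_def)
  have "\<bar>a * b'\<bar> \<le> int r * int s" "\<bar>b * a'\<bar> \<le> int r * int s"
    unfolding abs_mult using b1 b2 by (auto intro!: mult_mono)
  then have "\<bar>c + c' + a * b' - b * a'\<bar> \<le> int r ^ 2 + int s ^ 2 + int r * int s + int r * int s"
    using b1 b2 by linarith
  also have "\<dots> = int ((r + s) ^ 2)" by (simp add: power2_eq_square algebra_simps)
  finally show ?thesis
    using b1 b2 abs_triangle_ineq[of a a'] abs_triangle_ineq[of b b']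
    by (simp add: x y box_def mult_heisenberg)
qed

lemma box_mult_le: "x \<in> box r \<Longrightarrow> y \<in> box s \<Longrightarrow> r + s \<le> t \<Longrightarrow> x \<odot> y \<in> box t"
  using box_mult box_mono by blast

text \<open>The cardinality of a box is polynomial in its radius, so its relative boundary tends to
  0.\<close>

lemma box_almost_invariant:
  assumes "K \<ge> (1::nat)"
  obtains n where "real (card (box (n + \<rho>))) \<le> (1 + 1 / real K) * real (card (box n))"
proof -
  let ?p = "\<lambda>x::real. (2 * x + 1) ^ 2 * (2 * x ^ 2 + 1)"
  have "((\<lambda>n. ?p (real n + real \<rho>) / ?p (real n)) \<longlongrightarrow> 1) sequentially"
    by real_asymp
  moreover have "(1::real) < 1 + 1 / real K" using assms by simp
  ultimately have "\<forall>\<^sub>F n in sequentially. ?p (real n + real \<rho>) / ?p (real n) < 1 + 1 / real K"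
    by (rule order_tendstoD)
  then obtain n where n: "?p (real n + real \<rho>) / ?p (real n) < 1 + 1 / real K"
    by (auto simp: eventually_sequentially)
  have c: "real (card (box n)) = ?p (real n)" for n
    by (simp add: card_box algebra_simps)
  have pos: "?p (real n) > 0" by (intro mult_pos_pos zero_less_power add_nonneg_pos) auto
  from n pos have "?p (real n + real \<rho>) \<le> (1 + 1 / real K) * ?p (real n)"
    by (simp only: pos_divide_less_eq less_imp_le)
  then show ?thesis using that[of n] by (simp only: c of_nat_add)
qed

section \<open>Growth of the Heisenberg group\<close>

lemma graph_dist_leD:
  assumes "graph_dist G u v \<le> enat r"
  obtains p where "walk G p" "hd p = u" "last p = v" "length p \<le> r + 1"
proof -
  let ?A = "{p. walk G p \<and> hd p = u \<and> last p = v}"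
  have "?A \<noteq> {}"
  proof
    assume "?A = {}"
    then have "graph_dist G u v = \<infinity>" by (simp only: graph_dist_def image_empty Inf_enat_def) simp
    with assms show False by simp
  qed
  then have "graph_dist G u v \<in> (\<lambda>p. enat (length p - 1)) ` ?A"
    unfolding graph_dist_def by (auto simp: Inf_enat_def intro: LeastI)
  then obtain p where p: "p \<in> ?A" "graph_dist G u v = enat (length p - 1)" by blast
  then show ?thesis using that[of p] assms by auto
qed

lemma graph_dist_walk_le:
  "walk G p \<Longrightarrow> graph_dist G (hd p) (last p) \<le> enat (length p - 1)"
  unfolding graph_dist_def by (rule INF_lower) simp

lemma neighbour_in_coset:
  assumes "adjacent (cayley_graph heisenberg heisenberg_gens) x y"
  obtains s where "s \<in> box 1" "y = x \<odot> s"
proof -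
  obtain a b c where x: "x = (a, b, c)" by (cases x)
  let ?S = "{(1, 0, 0), (-1, 0, 0), (0, 1, 0), (0, -1, 0), (0, 0, 1), (0, 0, -1)} :: hpoint set"
  have "\<exists>s \<in> ?S. y = x \<odot> s"
    using assms by (auto simp: x adjacent_heisenberg mult_heisenberg)
  moreover have "?S \<subseteq> box 1" by (simp add: box_def)
  ultimately show ?thesis using that by blast
qed

lemma walk_end_in_coset:
  assumes "walk (cayley_graph heisenberg heisenberg_gens) p"
  shows "\<exists>g \<in> box (length p - 1). last p = hd p \<odot> g"
  using assms
proof (induction p rule: rev_induct)
  case Nil then show ?case by (simp add: walk_def)
next
  case (snoc y p)
  show ?case
  proof (cases "p = []")
    case True
    then show ?thesis using one_in_box by (cases y) (auto intro!: bexI[of _ "(0,0,0)"] simp: mult_heisenberg)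
  next
    case False
    with snoc.prems have w: "walk (cayley_graph heisenberg heisenberg_gens) p"
      and a: "adjacent (cayley_graph heisenberg heisenberg_gens) (last p) y"
      by (auto simp: walk_def successively_append_iff)
    obtain g where g: "g \<in> box (length p - 1)" "last p = hd p \<odot> g"
      using snoc.IH[OF w] by blast
    obtain s where s: "s \<in> box 1" "y = last p \<odot> s"
      using neighbour_in_coset[OF a] .
    have "length p - 1 + 1 = length p" using False by (cases p) auto
    then have "g \<odot> s \<in> box (length p)" using box_mult[OF g(1) s(1)] by simp
    then show ?thesis using False s g by (auto simp: hmult_assoc)
  qed
qed

lemma heisenberg_growth:
  assumes "1 \<le> r"
  shows "growth (cayley_graph heisenberg heisenberg_gens) r \<le> enat (27 * r ^ 4)"
  unfolding growth_def
proof (rule SUP_least)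
  fix v
  let ?B = "graph_ball (cayley_graph heisenberg heisenberg_gens) v r"
  have sub: "?B \<subseteq> (\<lambda>g. v \<odot> g) ` box r"
  proof
    fix w assume "w \<in> ?B"
    then have "graph_dist (cayley_graph heisenberg heisenberg_gens) v w \<le> enat r"
      by (simp add: graph_ball_def)
    then obtain p where p: "walk (cayley_graph heisenberg heisenberg_gens) p" "hd p = v" "last p = w"
        "length p \<le> r + 1"
      by (rule graph_dist_leD)
    moreover have "box (length p - 1) \<subseteq> box r" using p(4) by (intro box_mono) simp
    ultimately show "w \<in> (\<lambda>g. v \<odot> g) ` box r" using walk_end_in_coset[OF p(1)] by auto
  qed
  then have fin: "finite ?B" by (rule finite_subset) (simp add: finite_box)
  have "card ?B \<le> card ((\<lambda>g. v \<odot> g) ` box r)"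
    by (intro card_mono sub finite_imageI finite_box)
  also have "\<dots> \<le> card (box r)" by (rule card_image_le[OF finite_box])
  also have "\<dots> = (2 * r + 1) ^ 2 * (2 * r ^ 2 + 1)" by (rule card_box)
  also have "\<dots> \<le> (3 * r) ^ 2 * (3 * r ^ 2)"
    using assms by (intro mult_mono power_mono) (auto simp: power2_eq_square)
  also have "\<dots> = 27 * r ^ 4" by (simp add: power_mult_distrib flip: power_add)
  finally show "ecard ?B \<le> enat (27 * r ^ 4)" using fin by (simp add: ecard_def)
qed

section \<open>Trees are 0-hyperbolic\<close>

lemma adjacent_commute: "adjacent G u v \<longleftrightarrow> adjacent G v u"
  by (simp add: adjacent_def insert_commute)

lemma walk_Cons:
  "walk G (x # p) \<longleftrightarrow> x \<in> vertices G \<and> (p = [] \<or> walk G p \<and> adjacent G x (hd p))"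
  by (cases p) (auto simp: walk_def)

lemma walk_append:
  "walk G (p @ q) \<longleftrightarrow> (p = [] \<and> walk G q) \<or> (q = [] \<and> walk G p) \<or>
     (walk G p \<and> walk G q \<and> adjacent G (last p) (hd q))"
  by (auto simp: walk_def successively_append_iff)

lemma walk_rev: "walk G (rev p) \<longleftrightarrow> walk G p"
  by (simp add: walk_def adjacent_commute[of G])

lemma walk_to_path:
  assumes "walk G p"
  obtains q where "walk G q" "distinct q" "hd q = hd p" "last q = last p" "set q \<subseteq> set p"
  using assms
proof (induction "length p" arbitrary: p thesis rule: less_induct)
  case less
  show ?case
  proof (cases "distinct p")
    case True
    then show ?thesis using less.prems by blast
  next
    case False
    then obtain xs ys zs y where p: "p = xs @ [y] @ ys @ [y] @ zs"
      using not_distinct_decomp by blast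
    let ?q = "xs @ [y] @ zs"
    have "walk G ?q" using less.prems(2) unfolding p by (auto simp: walk_append walk_Cons)
    moreover have "hd ?q = hd p" "last ?q = last p" "set ?q \<subseteq> set p" "length ?q < length p"
      by (auto simp: p hd_append)
    ultimately show ?thesis
      using less.hyps[of ?q] less.prems(1) by (metis subset_trans)
  qed
qed

text \<open>A walk between two neighbours of \<open>v\<close> that missed \<open>v\<close> could be
  shortened to a path and then closed up through \<open>v\<close> to a cycle.\<close>

lemma acyclic_neighbours_separated:
  assumes acyclic: "\<nexists>p. cycle G p"
    and "adjacent G v u" "adjacent G v u'" "u \<noteq> u'" "v \<in> vertices G"
    and p: "walk G p" "hd p = u" "last p = u'"
  shows "v \<in> set p"
proof (rule ccontr)
  assume "v \<notin> set p"
  obtain q where q: "walk G q" "distinct q" "hd q = hd p" "last q = last p" "set q \<subseteq> set p"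
    using walk_to_path[OF p(1)] .
  have "q \<noteq> []" using q(1) by (simp add: walk_def)
  have "length q \<ge> 2"
  proof (rule ccontr)
    assume "\<not> length q \<ge> 2"
    then have "length q = Suc 0" using length_greater_0_conv[of q] \<open>q \<noteq> []\<close> by linarith
    then obtain x where "q = [x]" by (auto simp: length_Suc_conv)
    then show False using q p assms(4) by simp
  qed
  then have "cycle G (v # q)"
    using q p assms(2,3,5) \<open>v \<notin> set p\<close> \<open>q \<noteq> []\<close>
    by (auto simp: cycle_def walk_Cons adjacent_commute[of G u' v])
  then show False using acyclic by blast
qed

text \<open>Distances in a connected graph are finite, so they can be taken as natural numbers.\<close>

definition tdist :: "'a graph \<Rightarrow> 'a \<Rightarrow> 'a \<Rightarrow> nat" where
  "tdist G u v = the_enat (graph_dist G u v)"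

lemma tdist_le_walk:
  assumes "walk G p"
  shows "tdist G (hd p) (last p) \<le> length p - 1"
proof -
  have "graph_dist G (hd p) (last p) \<le> enat (length p - 1)" by (rule graph_dist_walk_le[OF assms])
  then show ?thesis unfolding tdist_def by (cases "graph_dist G (hd p) (last p)") auto
qed

context
  fixes F :: "'a graph"
  assumes tree: "tree F"
begin

lemma graph_dist_eq_tdist:
  assumes "u \<in> vertices F" "v \<in> vertices F"
  shows "graph_dist F u v = enat (tdist F u v)"
proof -
  obtain p where "walk F p" "hd p = u" "last p = v"
    using assms tree unfolding tree_def connected_graph_def by blast
  then have "graph_dist F u v \<le> enat (length p - 1)" using graph_dist_walk_le by metis
  then show ?thesis unfolding tdist_def by (cases "graph_dist F u v") auto
qed

lemma geodesic:
  assumes "u \<in> vertices F" "v \<in> vertices F"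
  obtains p where "walk F p" "hd p = u" "last p = v" "length p = tdist F u v + 1"
proof -
  have "graph_dist F u v \<le> enat (tdist F u v)" using graph_dist_eq_tdist[OF assms] by simp
  then obtain p where p: "walk F p" "hd p = u" "last p = v" "length p \<le> tdist F u v + 1"
    by (rule graph_dist_leD)
  moreover have "tdist F u v \<le> length p - 1" using tdist_le_walk[OF p(1)] p by simp
  moreover have "p \<noteq> []" using p(1) by (simp add: walk_def)
  ultimately have "length p = tdist F u v + 1" by (cases p) auto
  then show ?thesis using p that by blast
qed

lemma tdist_self: "u \<in> vertices F \<Longrightarrow> tdist F u u = 0"
  using tdist_le_walk[of F "[u]"] by (simp add: walk_def)

lemma tdist_commute:
  assumes "u \<in> vertices F" "v \<in> vertices F"
  shows "tdist F u v = tdist F v u"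
proof -
  have "tdist F y x \<le> tdist F x y" if xy: "x \<in> vertices F" "y \<in> vertices F" for x y
  proof -
    obtain p where p: "walk F p" "hd p = x" "last p = y" "length p = tdist F x y + 1"
      using geodesic[OF xy] .
    then have "p \<noteq> []" by auto
    then show ?thesis
      using tdist_le_walk[of F "rev p"] p by (simp add: walk_rev hd_rev last_rev)
  qed
  then show ?thesis using assms by (meson le_antisym)
qed

lemma tdist_triangle:
  assumes "u \<in> vertices F" "v \<in> vertices F" "w \<in> vertices F"
  shows "tdist F u w \<le> tdist F u v + tdist F v w"
proof -
  obtain p where p: "walk F p" "hd p = u" "last p = v" "length p = tdist F u v + 1"
    using geodesic[OF assms(1,2)] .
  obtain q where q: "walk F q" "hd q = v" "last q = w" "length q = tdist F v w + 1"
    using geodesic[OF assms(2,3)] .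
  obtain q' where q': "q = v # q'" using q by (cases q) auto
  have "p \<noteq> []" using p by auto
  have "walk F (p @ q')" using p q \<open>p \<noteq> []\<close> by (auto simp: q' walk_append walk_Cons)
  moreover have "hd (p @ q') = u" using p \<open>p \<noteq> []\<close> by simp
  moreover have "last (p @ q') = w" using p q \<open>p \<noteq> []\<close> by (auto simp: q' split: if_splits)
  ultimately have "tdist F u w \<le> length (p @ q') - 1" using tdist_le_walk by metis
  then show ?thesis using p q by (simp add: q')
qed

lemma tdist_adjacent_le:
  assumes "u \<in> vertices F" "v \<in> vertices F" "u = v \<or> adjacent F u v"
  shows "tdist F u v \<le> 1"
  using assms tdist_self[of u] tdist_le_walk[of F "[u, v]"] by (auto simp: walk_Cons)

lemma first_step:
  assumes "u \<in> vertices F" "v \<in> vertices F" "u \<noteq> v"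
  obtains p where "walk F p" "last p = v" "adjacent F u (hd p)" "hd p \<in> vertices F"
    "tdist F u v = Suc (tdist F (hd p) v)" "u \<notin> set p"
proof -
  obtain q where q: "walk F q" "hd q = u" "last q = v" "length q = tdist F u v + 1"
    using geodesic[OF assms(1,2)] .
  obtain p where p: "q = u # p" using q by (cases q) auto
  have "p \<noteq> []" using p q assms(3) by auto
  have w: "walk F p" "adjacent F u (hd p)" using q(1) \<open>p \<noteq> []\<close> by (auto simp: p walk_Cons)
  have l: "last p = v" using q \<open>p \<noteq> []\<close> by (simp add: p)
  have h: "hd p \<in> vertices F" using w \<open>p \<noteq> []\<close> by (auto simp: walk_def)
  have len: "length p = tdist F u v" using q by (simp add: p)
  have "tdist F (hd p) v \<le> length p - 1" using tdist_le_walk[OF w(1)] l by simp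
  moreover have "tdist F u v \<le> 1 + tdist F (hd p) v"
    using tdist_triangle[OF assms(1) h assms(2)] tdist_adjacent_le[OF assms(1) h] w(2) by linarith
  ultimately have d: "tdist F u v = Suc (tdist F (hd p) v)" using len \<open>p \<noteq> []\<close> by (cases p) auto
  have "u \<notin> set p"
  proof
    assume "u \<in> set p"
    then obtain xs ys where xs: "p = xs @ u # ys" by (meson split_list)
    then have "walk F (u # ys)" using w(1) by (auto simp: walk_append walk_Cons)
    then have "tdist F u v \<le> length (u # ys) - 1"
      using tdist_le_walk[of F "u # ys"] l xs by simp
    then show False using len xs by simp
  qed
  then show ?thesis using that w l h d by blast
qed

text \<open>Let the geodesics from \<open>u\<close> to \<open>v\<close> and to \<open>w\<close> start with different edges. A walk from
  \<open>v\<close> to \<open>w\<close> that missed \<open>u\<close> would then connect two neighbours of \<open>u\<close>, so every such walk visits \<open>u\<close>.\<close>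

lemma between_if_directions_differ:
  assumes V: "u \<in> vertices F" "v \<in> vertices F" "w \<in> vertices F"
    and p: "walk F p" "last p = v" "adjacent F u (hd p)" "u \<notin> set p"
    and q: "walk F q" "last q = w" "adjacent F u (hd q)" "u \<notin> set q"
    and ne: "hd p \<noteq> hd q"
  shows "tdist F v w = tdist F v u + tdist F u w"
proof (rule antisym[OF tdist_triangle[OF V(2,1,3)]])
  obtain r where r: "walk F r" "hd r = v" "last r = w" "length r = tdist F v w + 1"
    using geodesic[OF V(2,3)] .
  obtain r' where r': "r = v # r'" using r by (cases r) auto
  obtain q1 q' where q': "rev q = q1 # q'" using q(1) by (cases "rev q") (auto simp: walk_def)
  have q1: "q1 = w" using q(2) q' by (metis hd_rev list.sel(1))
  have ne0: "p \<noteq> []" "q \<noteq> []" using p(1) q(1) by (auto simp: walk_def)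
  let ?c = "p @ r' @ q'"
  have pr: "walk F (p @ r')" "last (p @ r') = w"
    using p r ne0 by (auto simp: r' walk_append walk_Cons split: if_splits)
  have wq: "walk F (w # q')" using q(1) q' q1 walk_rev[of F q] by simp
  have "walk F ((p @ r') @ q')"
    using pr wq ne0 unfolding walk_append[of F "p @ r'" q'] by (auto simp: walk_Cons)
  moreover have "hd ?c = hd p" using ne0 by simp
  moreover have "last ?c = hd q"
  proof (cases "q' = []")
    case True
    then have "hd q = w" using q' q1 ne0 by (metis last_ConsL last_rev)
    then show ?thesis using True pr(2) by simp
  next
    case False
    then show ?thesis using q' ne0 by (metis append_assoc last_ConsR last_appendR last_rev)
  qed
  ultimately have "u \<in> set ?c"
    using acyclic_neighbours_separated[of F u "hd p" "hd q" ?c] tree p(3) q(3) ne V(1)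
    by (simp add: tree_def)
  moreover have "set q' \<subseteq> set q" using q' by (metis set_rev set_subset_Cons)
  ultimately have "u \<in> set r" using p(4) q(4) by (auto simp: r')
  then obtain xs ys where xs: "r = xs @ u # ys" by (meson split_list)
  have "walk F (xs @ [u])" "walk F (u # ys)"
    using r(1) by (auto simp: xs walk_append walk_Cons)
  from tdist_le_walk[OF this(1)] tdist_le_walk[OF this(2)]
  have "tdist F v u \<le> length xs" "tdist F u w \<le> length ys"
    using r(2,3) by (auto simp: xs hd_append split: if_splits)
  then show "tdist F v u + tdist F u w \<le> tdist F v w" using r(4) by (simp add: xs)
qed

text \<open>Each of the three sums contains \<open>u\<close> exactly once. Hence, if the geodesics from
  \<open>u\<close> to the other three points start with the same edge, moving \<open>u\<close> along it
  lowers all three sums by 1, and induction applies. Otherwise \<open>u\<close> is one of these points or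
  lies between \<open>v\<close> and one of \<open>w\<close>, \<open>t\<close>, and the triangle inequality
  suffices.\<close>

lemma four_point:
  assumes "u \<in> vertices F" "v \<in> vertices F" "w \<in> vertices F" "t \<in> vertices F"
  shows "tdist F u v + tdist F w t \<le> max (tdist F u w + tdist F v t) (tdist F u t + tdist F v w)"
  using assms(1)
proof (induction "tdist F u v" arbitrary: u)
  case 0
  then show ?case
    using tdist_triangle[of w u t] tdist_triangle[of u v t] tdist_commute[of u w] tdist_triangle[of w v t]
      tdist_triangle[of v u t] assms tdist_commute[of u v] tdist_commute[of v w] tdist_commute[of u t]
    by linarith
next
  case (Suc n)
  note comm = tdist_commute[of u v] tdist_commute[of u w] tdist_commute[of u t]
    tdist_commute[of v w] tdist_commute[of v t] tdist_commute[of w t]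
  show ?case
  proof (cases "u = w \<or> u = t")
    case True
    then show ?thesis using tdist_self[OF assms(3)] tdist_self[OF assms(4)] comm Suc.prems assms by auto
  next
    case False
    have "u \<noteq> v" using Suc tdist_self by force
    obtain p where p: "walk F p" "last p = v" "adjacent F u (hd p)" "hd p \<in> vertices F"
        "tdist F u v = Suc (tdist F (hd p) v)" "u \<notin> set p"
      using first_step[OF Suc.prems assms(2) \<open>u \<noteq> v\<close>] .
    obtain q where q: "walk F q" "last q = w" "adjacent F u (hd q)" "hd q \<in> vertices F"
        "tdist F u w = Suc (tdist F (hd q) w)" "u \<notin> set q"
      using first_step[OF Suc.prems assms(3)] False by blast
    obtain r where r: "walk F r" "last r = t" "adjacent F u (hd r)" "hd r \<in> vertices F"
        "tdist F u t = Suc (tdist F (hd r) t)" "u \<notin> set r"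
      using first_step[OF Suc.prems assms(4)] False by blast
    have tri: "tdist F w t \<le> tdist F w u + tdist F u t"
      by (rule tdist_triangle[OF assms(3) Suc.prems assms(4)])
    consider "hd p \<noteq> hd q" | "hd p \<noteq> hd r" | "hd q = hd p" "hd r = hd p" by metis
    then show ?thesis
    proof cases
      case 1
      then have "tdist F v w = tdist F v u + tdist F u w"
        using between_if_directions_differ[OF Suc.prems assms(2,3)] p q by blast
      then show ?thesis using tri comm Suc.prems assms by simp
    next
      case 2
      then have "tdist F v t = tdist F v u + tdist F u t"
        using between_if_directions_differ[OF Suc.prems assms(2,4)] p r by blast
      then show ?thesis using tri comm Suc.prems assms by simp
    next
      case 3
      have "n = tdist F (hd p) v" using Suc.hyps(2) p(5) by simp
      from Suc.hyps(1)[OF this p(4)] show ?thesis using p(5) q(5) r(5) 3 by simp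
    qed
  qed
qed

end

section \<open>Collapse of the centre\<close>

text \<open>The two horizontal one-parameter subgroups are indexed by truth values, so that statements
  about both directions need to be proved only once.\<close>

definition axis :: "bool \<Rightarrow> int \<Rightarrow> hpoint" where
  "axis S n = (if S then (n, 0, 0) else (0, n, 0))"

lemma axis_add: "axis S i \<odot> axis S j = axis S (i + j)"
  by (simp add: axis_def mult_heisenberg)

lemma axis_add': "y \<odot> axis S i \<odot> axis S j = y \<odot> axis S (i + j)"
  by (simp add: hmult_assoc axis_add)

lemma axis_0 [simp]: "axis S 0 = (0, 0, 0)"
  by (simp add: axis_def)

lemma hmult_one [simp]: "(0, 0, 0) \<odot> y = y" "y \<odot> (0, 0, 0) = y"
  by (cases y; simp add: mult_heisenberg)+

lemma axis_in_box: "\<bar>n\<bar> \<le> int r \<Longrightarrow> axis S n \<in> box r"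
  by (auto simp: axis_def box_def)

lemma centre_in_box:
  assumes "i \<le> J"
  shows "(0, 0, 2 * int i) \<in> box (2 * J)"
proof -
  have "i \<le> J * J" using assms by (cases J) auto
  then have "2 * i \<le> (2 * J) ^ 2" by (simp add: power2_eq_square)
  then have "int (2 * i) \<le> int ((2 * J) ^ 2)" by (simp only: of_nat_le_iff)
  then show ?thesis by (simp add: box_def)
qed

text \<open>Parallel lines diverge like a square root: moving \<open>g\<close> past \<open>axis S
  n\<close> changes only the central coordinate of \<open>g\<close>, by \<open>O(w n)\<close>, and an
  element \<open>(0, 0, c)\<close> has norm of the order of the square root of \<open>c\<close>.\<close>

lemma commute_past_axis:
  assumes "g \<in> box w" "1 \<le> w" "1 \<le> s" "\<bar>n\<bar> \<le> int (s ^ 2)"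
  obtains h where "g \<odot> axis S n = axis S n \<odot> h" "h \<in> box (2 * w * s)"
proof -
  obtain i j k where g: "g = (i, j, k)" by (cases g)
  let ?l = "if S then - j else i"
  let ?h = "(i, j, k + 2 * n * ?l)"
  have b: "\<bar>i\<bar> \<le> int w" "\<bar>j\<bar> \<le> int w" "\<bar>k\<bar> \<le> int w ^ 2"
    using assms(1) by (auto simp: g box_def)
  have "\<bar>n * ?l\<bar> \<le> int s ^ 2 * int w"
    unfolding abs_mult using b assms(4) by (intro mult_mono) auto
  then have "\<bar>k + 2 * n * ?l\<bar> \<le> int w ^ 2 + 2 * (int s ^ 2 * int w)"
    using b(3) abs_triangle_ineq[of k "2 * n * ?l"] by (simp only: abs_mult mult.assoc abs_numeral)
  also have "\<dots> \<le> int w ^ 2 * int s ^ 2 + 2 * (int s ^ 2 * int w ^ 2)"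
    using assms(2,3) power_increasing[of 1 2 "int w"] power_mono[of 1 "int s" 2]
    by (intro add_mono mult_left_mono) (auto simp: mult_le_cancel_left1)
  also have "\<dots> \<le> int ((2 * w * s) ^ 2)"
    by (simp add: power_mult_distrib)
  finally have c: "\<bar>k + 2 * n * ?l\<bar> \<le> int ((2 * w * s) ^ 2)" .
  have "w * 1 \<le> w * (2 * s)" using assms(3) by (intro mult_le_mono) auto
  then have "int w \<le> int (2 * w * s)" by (simp only: of_nat_le_iff mult_1_right ac_simps)
  then have "?h \<in> box (2 * w * s)"
    using b c unfolding box_def mem_Collect_eq case_prod_conv by (meson order_trans)
  moreover have "g \<odot> axis S n = axis S n \<odot> ?h"
    by (simp add: g axis_def mult_heisenberg algebra_simps)
  ultimately show ?thesis using that by blast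
qed

text \<open>The distances that a Lipschitz map to a tree induces on the group. Four-point hyperbolicity is
  all that the collapse uses of trees. The Lipschitz constant is normalised with respect to boxes.\<close>

locale hyperbolic_lipschitz =
  fixes d :: "hpoint \<Rightarrow> hpoint \<Rightarrow> real"
  assumes d_self [simp]: "d x x = 0"
    and d_sym: "d x y = d y x"
    and d_tri: "d x z \<le> d x y + d y z"
    and d_four_point: "d u v + d x y \<le> max (d u x + d v y) (d u y + d v x)"
    and d_box: "g \<in> box t \<Longrightarrow> d y (y \<odot> g) \<le> real t"
begin

lemma d_nonneg: "0 \<le> d x y"
  using d_tri[of x x y] d_sym[of x y] by simp

lemma parallel_lines_close:
  assumes "g \<in> box w" "1 \<le> w" "1 \<le> s" "\<bar>n\<bar> \<le> int (s ^ 2)"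
  shows "d (y \<odot> axis S n) (y \<odot> g \<odot> axis S n) \<le> 2 * real w * real s"
proof -
  obtain h where h: "g \<odot> axis S n = axis S n \<odot> h" "h \<in> box (2 * w * s)"
    using commute_past_axis[OF assms] .
  have "y \<odot> g \<odot> axis S n = y \<odot> axis S n \<odot> h" by (simp add: hmult_assoc h(1))
  then show ?thesis using d_box[OF h(2), of "y \<odot> axis S n"] by simp
qed

text \<open>In a tree, a point between \<open>p'\<close> and \<open>q\<close> stays between
  \<open>p\<close> and \<open>q\<close> when the endpoint is displaced by less than its distance from that
  point.\<close>

lemma between_shift:
  assumes "d p' y + d y q \<le> d p' q + e" "d p p' + e < d p' y"
  shows "d p y + d y q \<le> d p q + e"
  using d_four_point[of p y p' q] assms d_sym[of p' y] d_nonneg[of p y] by (auto simp: max_def split: if_splits)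

definition uniform_line :: "nat \<Rightarrow> real \<Rightarrow> bool \<Rightarrow> hpoint \<Rightarrow> real \<Rightarrow> bool" where
  "uniform_line Q \<eta> S y v \<longleftrightarrow> (\<forall>i j. - int Q \<le> i \<and> i \<le> j \<and> j \<le> int Q \<longrightarrow>
     \<bar>d (y \<odot> axis S i) (y \<odot> axis S j) - of_int (j - i) * v\<bar> \<le> \<eta>)"

lemma uniform_lineD:
  assumes "uniform_line Q \<eta> S y v" "- int Q \<le> i" "i \<le> j" "j \<le> int Q"
  shows "\<bar>d (y \<odot> axis S i) (y \<odot> axis S j) - of_int (j - i) * v\<bar> \<le> \<eta>"
  using assms unfolding uniform_line_def by blast

lemma uniform_line_ends:
  assumes "uniform_line Q \<eta> S y v"
  shows "\<bar>d (y \<odot> axis S (- int Q)) (y \<odot> axis S (int Q)) - 2 * real Q * v\<bar> \<le> \<eta>"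
    "\<bar>d (y \<odot> axis S (- int Q)) y - real Q * v\<bar> \<le> \<eta>"
    "\<bar>d y (y \<odot> axis S (int Q)) - real Q * v\<bar> \<le> \<eta>"
  using uniform_lineD[OF assms, of "- int Q" "int Q"] uniform_lineD[OF assms, of "- int Q" 0]
    uniform_lineD[OF assms, of 0 "int Q"] by (simp_all add: algebra_simps)

text \<open>In the following, all lines through points of a box are uniform over a length of order \<open>s\<^sup>2\<close>,
  where \<open>s\<close> is meant to be much larger than the radius \<open>w\<close> of the box.\<close>

context
  fixes w s :: nat and \<eta> :: real and v :: "bool \<Rightarrow> hpoint \<Rightarrow> real"
  assumes w: "1 \<le> w" and s: "1 \<le> s" and \<eta>: "0 \<le> \<eta>"
    and lines: "\<And>S y. y \<in> box w \<Longrightarrow> uniform_line (s ^ 2) \<eta> S y (v S y)"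
begin

text \<open>Compare the line through \<open>y\<close> with the parallel line from \<open>p\<close> to
  \<open>q\<close> through the identity. Their endpoints are at distance at most \<open>2 w s\<close>,
  which is less than the half-length of their images. So \<open>y\<close>, the midpoint of its own line,
  lies between \<open>p\<close> and \<open>q\<close>. Points between \<open>p\<close> and \<open>q\<close>
  are determined, in a tree, by their distance from \<open>p\<close>, which is the coordinate
  \<open>u\<close>.\<close>

lemma fast_line_gives_coordinate:
  assumes fast: "4 * real w * real s + 5 * \<eta> < real (s ^ 2) * v S (0, 0, 0)"
  obtains u where
    "\<And>x y. \<lbrakk>x \<in> box w; y \<in> box w\<rbrakk> \<Longrightarrow> \<bar>u x - u y\<bar> \<le> d x y"
    "\<And>x y. \<lbrakk>x \<in> box w; y \<in> box w\<rbrakk> \<Longrightarrow> d x y \<le> \<bar>u x - u y\<bar> + 3 * \<eta>"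
proof -
  let ?Q = "s ^ 2"
  let ?p = "axis S (- int ?Q)" and ?q = "axis S (int ?Q)"
  define D where "D = 2 * real w * real s"
  have pq: "\<bar>d ?p ?q - 2 * real ?Q * v S (0, 0, 0)\<bar> \<le> \<eta>"
    using uniform_line_ends(1)[OF lines[OF one_in_box]] by simp
  have between: "d ?p y + d y ?q \<le> d ?p ?q + 3 * \<eta>" if y: "y \<in> box w" for y
  proof -
    let ?p' = "y \<odot> axis S (- int ?Q)" and ?q' = "y \<odot> axis S (int ?Q)"
    have pp: "d ?p ?p' \<le> D" and qq: "d ?q ?q' \<le> D"
      using parallel_lines_close[OF y w s, of "- int ?Q" "(0,0,0)" S]
        parallel_lines_close[OF y w s, of "int ?Q" "(0,0,0)" S] by (simp_all add: D_def)
    note e = uniform_line_ends[OF lines[OF y], of S]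
    have "d ?p ?q \<le> d ?p ?p' + d ?p' ?q' + d ?q ?q'"
      using d_tri[of ?p ?q ?p'] d_tri[of ?p' ?q ?q'] d_sym[of ?q ?q'] by linarith
    \<comment> \<open>The speed at \<open>y\<close> is close to the speed at the identity, since the endpoints are.\<close>
    then have long: "real ?Q * v S y > D + 4 * \<eta>"
      using pp qq e(1) pq fast unfolding D_def by linarith
    have "d ?p' y + d y ?q' \<le> d ?p' ?q' + 3 * \<eta>" using e by linarith
    moreover have "d ?p ?p' + 3 * \<eta> < d ?p' y" using pp e long by linarith
    ultimately have "d ?p y + d y ?q' \<le> d ?p ?q' + 3 * \<eta>" by (rule between_shift)
    then have "d ?q' y + d y ?p \<le> d ?q' ?p + 3 * \<eta>"
      using d_sym[of ?p y] d_sym[of y ?q'] d_sym[of ?p ?q'] by linarith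
    moreover have "d ?q ?q' + 3 * \<eta> < d ?q' y" using qq e long d_sym[of ?q' y] by linarith
    ultimately have "d ?q y + d y ?p \<le> d ?q ?p + 3 * \<eta>" by (rule between_shift)
    then show ?thesis using d_sym[of ?p y] d_sym[of y ?q] d_sym[of ?p ?q] by linarith
  qed
  show ?thesis
  proof (rule that[of "d ?p"])
    fix x y assume x: "x \<in> box w" and y: "y \<in> box w"
    show "\<bar>d ?p x - d ?p y\<bar> \<le> d x y"
      using d_tri[of ?p x y] d_tri[of ?p y x] d_sym[of x y] by linarith
    show "d x y \<le> \<bar>d ?p x - d ?p y\<bar> + 3 * \<eta>"
      using d_four_point[of ?p ?q x y] between[OF x] between[OF y] d_sym[of x ?q] d_sym[of y ?q]
      by (auto simp: max_def split: if_splits)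
  qed
qed

text \<open>Endpoints of parallel lines being close, a low speed at the identity bounds the speeds at all
  points of the box.\<close>

lemma slow_line_gives_small_steps:
  assumes slow: "real (s ^ 2) * v S (0, 0, 0) \<le> 4 * real w * real s + 5 * \<eta>" and y: "y \<in> box w"
  shows "d y (y \<odot> axis S 1) \<le> 6 * real w / real s + 7 * \<eta>"
proof -
  let ?Q = "s ^ 2"
  let ?p = "axis S (- int ?Q)" and ?q = "axis S (int ?Q)"
  let ?p' = "y \<odot> axis S (- int ?Q)" and ?q' = "y \<odot> axis S (int ?Q)"
  define D where "D = 2 * real w * real s"
  have Q1: "1 \<le> real ?Q" using s by simp
  have pq: "\<bar>d ?p ?q - 2 * real ?Q * v S (0, 0, 0)\<bar> \<le> \<eta>"
    using uniform_line_ends(1)[OF lines[OF one_in_box]] by simp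
  have pp: "d ?p ?p' \<le> D" and qq: "d ?q ?q' \<le> D"
    using parallel_lines_close[OF y w s, of "- int ?Q" "(0,0,0)" S]
      parallel_lines_close[OF y w s, of "int ?Q" "(0,0,0)" S] by (simp_all add: D_def)
  have "d ?p' ?q' \<le> d ?p ?p' + d ?p ?q + d ?q ?q'"
    using d_tri[of ?p' ?q' ?p] d_tri[of ?p ?q' ?q] d_sym[of ?p ?p'] by linarith
  then have "real ?Q * v S y \<le> 3 * D + 6 * \<eta>"
    using pp qq uniform_line_ends(1)[OF lines[OF y], of S] pq slow unfolding D_def by linarith
  then have "v S y \<le> (3 * D + 6 * \<eta>) / real ?Q"
    using s by (simp add: pos_le_divide_eq mult.commute)
  also have "\<dots> = 6 * real w / real s + 6 * \<eta> / real ?Q"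
    using s by (simp add: D_def add_divide_distrib power2_eq_square)
  also have "\<dots> \<le> 6 * real w / real s + 6 * \<eta>"
    using Q1 \<eta> by (simp add: divide_le_eq mult_le_cancel_left1)
  finally have "v S y \<le> 6 * real w / real s + 6 * \<eta>" .
  moreover have "1 \<le> int ?Q" using s by simp
  then have "\<bar>d y (y \<odot> axis S 1) - v S y\<bar> \<le> \<eta>"
    using uniform_lineD[OF lines[OF y], of 0 1 S] by simp
  ultimately show ?thesis by linarith
qed

text \<open>Now \<open>u\<close> is a real coordinate for the map on the box. The parameter \<open>r\<close> is the square root of
  the length of the lines on which slopes are compared.\<close>

context
  fixes u :: "hpoint \<Rightarrow> real" and r :: nat
  assumes u_le: "\<And>x y. \<lbrakk>x \<in> box w; y \<in> box w\<rbrakk> \<Longrightarrow> \<bar>u x - u y\<bar> \<le> d x y"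
    and u_ge: "\<And>x y. \<lbrakk>x \<in> box w; y \<in> box w\<rbrakk> \<Longrightarrow> d x y \<le> \<bar>u x - u y\<bar> + 3 * \<eta>"
    and s2: "2 \<le> s" and r: "1 \<le> r"
begin

definition slope :: "bool \<Rightarrow> hpoint \<Rightarrow> real" where
  "slope S y = u (y \<odot> axis S 1) - u y"

text \<open>Two consecutive steps have nearly the same length \<open>v\<close>, and together they have
  length nearly \<open>2 v\<close>. Real increments of this kind must also have the same sign, unless
  \<open>v\<close> itself is small.\<close>

lemma slope_along_line:
  assumes y: "y \<in> box m" "m + 2 \<le> w"
  shows "\<bar>slope S (y \<odot> axis S 1) - slope S y\<bar> \<le> 6 * \<eta>"
proof -
  let ?y1 = "y \<odot> axis S 1" and ?y2 = "y \<odot> axis S 2"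
  have eq: "?y1 \<odot> axis S 1 = ?y2" by (simp add: axis_add')
  have B: "y \<in> box w" "?y1 \<in> box w" "?y2 \<in> box w"
    using y box_mono[of m w] box_mult_le[OF y(1) axis_in_box[of 1 1 S]]
      box_mult_le[OF y(1) axis_in_box[of 2 2 S]] by auto
  have "2 ^ 2 \<le> s ^ 2" using s2 by (rule power_mono) simp
  then have "2 \<le> s ^ 2" by simp
  then have Q: "2 \<le> int (s ^ 2)" by (metis of_nat_le_iff of_nat_numeral)
  note l = uniform_lineD[OF lines[OF B(1), of S]]
  have "\<bar>d y ?y1 - v S y\<bar> \<le> \<eta>" "\<bar>d y ?y2 - 2 * v S y\<bar> \<le> \<eta>" "\<bar>d ?y1 ?y2 - v S y\<bar> \<le> \<eta>"
    using l[of 0 1] l[of 0 2] l[of 1 2] Q by simp_all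
  then show ?thesis
    using u_le[OF B(1,2)] u_le[OF B(2,3)] u_ge[OF B(1,3)]
    unfolding slope_def eq by linarith
qed

lemma almost_affine:
  assumes y: "y \<in> box m" "m + n + 1 \<le> w"
  shows "\<bar>slope S (y \<odot> axis S (int n)) - slope S y\<bar> \<le> real n * (6 * \<eta>)" (is ?A)
    and "\<bar>u (y \<odot> axis S (int n)) - u y - real n * slope S y\<bar> \<le> real n ^ 2 * (6 * \<eta>)" (is ?B)
proof -
  have "?A \<and> ?B" using y(2)
  proof (induction n)
    case (Suc n)
    let ?y = "y \<odot> axis S (int n)"
    have e: "?y \<odot> axis S 1 = y \<odot> axis S (int (Suc n))"
      by (simp add: axis_add' add.commute)
    have B: "?y \<in> box (m + n)" using box_mult[OF y(1)] axis_in_box[of "int n" n S] by simp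
    have 1: "\<bar>slope S (y \<odot> axis S (int (Suc n))) - slope S ?y\<bar> \<le> 6 * \<eta>"
      using slope_along_line[OF B, of S] Suc.prems unfolding e by simp
    have 2: "u (y \<odot> axis S (int (Suc n))) = u ?y + slope S ?y" by (simp add: slope_def e)
    have IH: "\<bar>slope S ?y - slope S y\<bar> \<le> real n * (6 * \<eta>)"
      "\<bar>u ?y - u y - real n * slope S y\<bar> \<le> real n ^ 2 * (6 * \<eta>)"
      using Suc by auto
    have "real (Suc n) * (6 * \<eta>) = real n * (6 * \<eta>) + 6 * \<eta>" by (simp add: algebra_simps)
    then have A: "\<bar>slope S (y \<odot> axis S (int (Suc n))) - slope S y\<bar> \<le> real (Suc n) * (6 * \<eta>)"
      using 1 IH(1) by linarith
    have "real (Suc n) ^ 2 * (6 * \<eta>) = real n ^ 2 * (6 * \<eta>) + real n * (6 * \<eta>) + real n * (6 * \<eta>) + 6 * \<eta>"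
      by (simp add: algebra_simps power2_eq_square)
    moreover have "0 \<le> real n * (6 * \<eta>)" using \<eta> by simp
    moreover have "real (Suc n) * slope S y = real n * slope S y + slope S y" by (simp add: algebra_simps)
    ultimately have "\<bar>u (y \<odot> axis S (int (Suc n))) - u y - real (Suc n) * slope S y\<bar>
        \<le> real (Suc n) ^ 2 * (6 * \<eta>)"
      unfolding 2 using IH \<eta> by linarith
    with A show ?case by blast
  qed (simp add: slope_def)
  then show ?A ?B by auto
qed

text \<open>Follow two neighbouring parallel lines for \<open>r\<^sup>2\<close> steps. They are then at
  distance at most \<open>2 r\<close>, so a difference of slopes can be at most of order \<open>r /
  r\<^sup>2\<close>, up to the deviation of both lines from affine ones.\<close>

lemma slope_across_lines:
  assumes y: "y \<in> box m" "m + r ^ 2 + 2 \<le> w"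
  shows "\<bar>slope S (y \<odot> axis S' 1) - slope S y\<bar> \<le> 3 / real r + 12 * real r ^ 2 * \<eta>"
proof -
  let ?n = "r ^ 2"
  let ?x = "y \<odot> axis S' 1"
  let ?yn = "y \<odot> axis S (int ?n)" and ?xn = "?x \<odot> axis S (int ?n)"
  have g: "axis S' 1 \<in> box 1" by (rule axis_in_box) simp
  have x: "?x \<in> box (m + 1)" using box_mult[OF y(1) g] .
  have n: "axis S (int ?n) \<in> box ?n" by (rule axis_in_box) simp
  have B: "y \<in> box w" "?x \<in> box w" "?yn \<in> box w" "?xn \<in> box w"
    using y(2) box_mono[of m w] y(1) box_mono[of "m + 1" w] x box_mult_le[OF y(1) n]
      box_mult_le[OF x n] by auto
  have ends: "\<bar>u ?xn - u ?yn\<bar> \<le> 2 * real r"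
    using u_le[OF B(4,3)] parallel_lines_close[OF g _ r, of "int ?n" y S] d_sym[of ?xn ?yn] by simp
  have start: "\<bar>u ?x - u y\<bar> \<le> 1"
    using u_le[OF B(2,1)] d_box[OF g, of y] d_sym[of ?x y] by simp
  have "\<bar>real ?n * slope S ?x - real ?n * slope S y\<bar> \<le> 2 * real r + 1 + 2 * (real ?n ^ 2 * (6 * \<eta>))"
    using almost_affine(2)[OF y(1), of ?n S] almost_affine(2)[OF x, of ?n S] y(2) ends start
    by linarith
  then have "real ?n * \<bar>slope S ?x - slope S y\<bar> \<le> 2 * real r + 1 + 2 * (real ?n ^ 2 * (6 * \<eta>))"
    by (simp add: abs_mult flip: right_diff_distrib)
  also have "\<dots> \<le> 3 * real r + 2 * (real ?n ^ 2 * (6 * \<eta>))" using r by simp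
  also have "\<dots> = real ?n * (3 / real r + 12 * real r ^ 2 * \<eta>)"
    using r by (simp add: field_simps power2_eq_square)
  finally show ?thesis using r by (simp add: mult_le_cancel_left)
qed

text \<open>With \<open>z = (0, 0, 1)\<close>, the paths \<open>y, y a, y a b\<close> and \<open>y
  z\<^sup>2, y z\<^sup>2 b, y z\<^sup>2 b a\<close> have the same endpoint. As both consist of one step in
  each direction and slopes are nearly constant, \<open>u\<close> takes nearly the same value at their
  starting points.\<close>

lemma central_step:
  assumes y: "y \<in> box m" "m + r ^ 2 + 6 \<le> w"
  shows "d y (y \<odot> (0, 0, 2)) \<le> 6 / real r + 24 * real r ^ 2 * \<eta> + 27 * \<eta>"
proof -
  let ?a = "axis True 1" and ?b = "axis False 1"
  let ?z = "y \<odot> (0, 0, 2)"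
  let ?c = "?z \<odot> ?b"
  define \<tau> where "\<tau> = 3 / real r + 12 * real r ^ 2 * \<eta>"
  have top: "y \<odot> ?a \<odot> ?b = ?c \<odot> ?a"
    by (cases y) (simp add: axis_def mult_heisenberg)
  have g: "axis S 1 \<in> box 1" for S by (rule axis_in_box) simp
  have ya: "y \<odot> ?a \<in> box (m + 1)" using box_mult[OF y(1) g] .
  have yab: "y \<odot> ?a \<odot> ?b \<in> box (m + 2)" using box_mult[OF ya g[of False]] by (simp add: add.assoc)
  have z: "?z \<in> box (m + 2)" using box_mult[OF y(1), of "(0,0,2)" 2] by (simp add: box_def)
  have c: "?c \<in> box (m + 3)" using box_mult[OF z g[of False]] by (simp add: numeral_eq_Suc)
  \<comment> \<open>The two steps in direction \<open>a\<close> start at \<open>y\<close> and \<open>?c\<close>. These points are joined by the path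
    \<open>y, y a, y a b = ?c a, ?c\<close>, along which the slope is compared edge by edge.\<close>
  have "\<bar>slope True (y \<odot> ?a) - slope True y\<bar> \<le> 6 * \<eta>"
    "\<bar>slope True (y \<odot> ?a \<odot> ?b) - slope True (y \<odot> ?a)\<bar> \<le> \<tau>"
    "\<bar>slope True (?c \<odot> ?a) - slope True ?c\<bar> \<le> 6 * \<eta>"
    using slope_along_line[OF y(1), of True] slope_across_lines[OF ya, of True False]
      slope_along_line[OF c, of True] y(2) by (simp_all add: \<tau>_def)
  moreover
  \<comment> \<open>The two steps in direction \<open>b\<close> start at \<open>y a\<close> and \<open>?z\<close>, joined by \<open>y a, y a b = ?c a, ?c, ?z\<close>.\<close>
  have "\<bar>slope False (y \<odot> ?a \<odot> ?b) - slope False (y \<odot> ?a)\<bar> \<le> 6 * \<eta>"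
    "\<bar>slope False (?c \<odot> ?a) - slope False ?c\<bar> \<le> \<tau>"
    "\<bar>slope False ?c - slope False ?z\<bar> \<le> 6 * \<eta>"
    using slope_along_line[OF ya, of False] slope_across_lines[OF c, of False True]
      slope_along_line[OF z, of False] y(2) by (simp_all add: \<tau>_def)
  ultimately have "\<bar>slope True ?c - slope True y\<bar> \<le> 12 * \<eta> + \<tau>"
    "\<bar>slope False ?z - slope False (y \<odot> ?a)\<bar> \<le> 12 * \<eta> + \<tau>"
    unfolding top by linarith+
  moreover have "u (y \<odot> ?a \<odot> ?b) = u y + slope True y + slope False (y \<odot> ?a)"
    "u (?c \<odot> ?a) = u ?z + slope False ?z + slope True ?c"
    by (simp_all add: slope_def)
  ultimately have "\<bar>u y - u ?z\<bar> \<le> 24 * \<eta> + 2 * \<tau>"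
    unfolding top by linarith
  moreover have "y \<in> box w" "?z \<in> box w"
    using y(2) box_mono[of m w] y(1) box_mono[of "m + 2" w] z by auto
  then have "d y ?z \<le> \<bar>u y - u ?z\<bar> + 3 * \<eta>" by (rule u_ge)
  ultimately show ?thesis by (simp add: \<tau>_def algebra_simps)
qed

end

end

lemma central_chain:
  assumes "\<And>i. i < j \<Longrightarrow> d (0, 0, 2 * int i) ((0, 0, 2 * int i) \<odot> (0, 0, 2)) \<le> \<sigma>"
  shows "d (0, 0, 0) (0, 0, 2 * int j) \<le> real j * \<sigma>"
  using assms
proof (induction j)
  case (Suc j)
  have "(0, 0, 2 * int j) \<odot> (0, 0, 2) = (0, 0, 2 * int (Suc j))" by (simp add: mult_heisenberg)
  then have "d (0, 0, 2 * int j) (0, 0, 2 * int (Suc j)) \<le> \<sigma>" using Suc.prems[of j] by simp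
  moreover have "d (0, 0, 0) (0, 0, 2 * int j) \<le> real j * \<sigma>" using Suc by simp
  moreover have "real (Suc j) * \<sigma> = real j * \<sigma> + \<sigma>" by (simp add: algebra_simps)
  ultimately show ?case using d_tri[of "(0,0,0)" "(0, 0, 2 * int (Suc j))" "(0, 0, 2 * int j)"] by linarith
qed simp

lemma slow_steps_central:
  assumes y: "y \<in> box m" "m + 3 \<le> w"
    and steps: "\<And>S x. x \<in> box w \<Longrightarrow> d x (x \<odot> axis S 1) \<le> \<sigma>"
  shows "d y (y \<odot> (0, 0, 2)) \<le> 4 * \<sigma>"
proof -
  let ?a = "axis True 1" and ?b = "axis False 1"
  let ?z = "y \<odot> (0, 0, 2)"
  let ?c = "?z \<odot> ?b"
  have top: "y \<odot> ?a \<odot> ?b = ?c \<odot> ?a"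
    by (cases y) (simp add: axis_def mult_heisenberg)
  have g: "axis S 1 \<in> box 1" for S by (rule axis_in_box) simp
  have z: "?z \<in> box (m + 2)" using box_mult[OF y(1), of "(0,0,2)" 2] by (simp add: box_def)
  have "y \<in> box w" "y \<odot> ?a \<in> box w" "?z \<in> box w" "?c \<in> box w"
    using y(2) box_mono[of m w] y(1) box_mult_le[OF y(1) g] box_mono[of "m + 2" w] z
      box_mult_le[OF z g] by auto
  then have "d y (y \<odot> ?a) \<le> \<sigma>" "d (y \<odot> ?a) (?c \<odot> ?a) \<le> \<sigma>" "d ?c (?c \<odot> ?a) \<le> \<sigma>" "d ?z ?c \<le> \<sigma>"
    using steps[of y True] steps[of "y \<odot> ?a" False] steps[of ?c True] steps[of ?z False]
    unfolding top by auto
  then show ?thesis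
    using d_tri[of y ?z "y \<odot> ?a"] d_tri[of "y \<odot> ?a" ?z "?c \<odot> ?a"] d_tri[of "?c \<odot> ?a" ?z ?c]
      d_sym[of ?c "?c \<odot> ?a"] d_sym[of ?z ?c] by linarith
qed

end

text \<open>The constants depend only on \<open>J\<close>, not on the metric. They are chosen in the order
  \<open>r\<close>, \<open>\<eta>\<close>, \<open>w\<close>, \<open>s\<close> such that in both cases (one
  direction is fast, or both are slow) each of the \<open>J\<close> central steps costs at most \<open>1 /
  J\<close>, of which one half is due to \<open>r\<close> or \<open>s\<close> and the other half to
  \<open>\<eta>\<close>.\<close>

lemma uniform_lines_collapse_centre:
  assumes "1 \<le> (J::nat)"
  obtains w s \<eta> where "0 < \<eta>" "1 \<le> s"
    "\<And>d j. \<lbrakk>hyperbolic_lipschitz d;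
       \<And>S y. y \<in> box w \<Longrightarrow> \<exists>v. hyperbolic_lipschitz.uniform_line d (s ^ 2) \<eta> S y v; j \<le> J\<rbrakk>
       \<Longrightarrow> d (0, 0, 0) (0, 0, 2 * int j) \<le> 1"
proof -
  define r where "r = 12 * J"
  define \<eta> where "\<eta> = 1 / (102 * real J * real r ^ 2)"
  \<comment> \<open>Radius \<open>2 J\<close> contains the central elements, and \<open>r\<^sup>2 + 6\<close> leaves room for the paths around them.\<close>
  define w where "w = 2 * J + r ^ 2 + 6"
  define s where "s = 48 * J * w"
  have r: "1 \<le> r" and w: "1 \<le> w" using assms by (auto simp: r_def w_def)
  have s: "2 \<le> s" using assms w mult_le_mono[of 1 J 1 w] by (simp add: s_def mult.assoc)
  have \<eta>: "0 < \<eta>" using assms r by (simp add: \<eta>_def)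
  have J\<eta>: "real J * real r ^ 2 * \<eta> = 1 / 102" using assms r by (simp add: \<eta>_def)
  have "1 \<le> real r ^ 2" using r by simp
  then have "real J * \<eta> * 1 \<le> real J * \<eta> * real r ^ 2"
    using \<eta> by (intro mult_left_mono) auto
  then have J\<eta>': "real J * \<eta> \<le> 1 / 102" using J\<eta> by (simp add: mult_ac)
  show ?thesis
  proof (rule that[of \<eta> s w])
    show "0 < \<eta>" "1 \<le> s" using \<eta> s by auto
    fix d :: "hpoint \<Rightarrow> hpoint \<Rightarrow> real" and j
    assume "hyperbolic_lipschitz d" and j: "j \<le> J"
      and ex: "\<And>S y. y \<in> box w \<Longrightarrow> \<exists>v. hyperbolic_lipschitz.uniform_line d (s ^ 2) \<eta> S y v"
    interpret hyperbolic_lipschitz d by fact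
    define v where "v S y = (SOME v. uniform_line (s ^ 2) \<eta> S y v)" for S y
    have lines: "uniform_line (s ^ 2) \<eta> S y (v S y)" if "y \<in> box w" for S y
      unfolding v_def using ex[OF that] by (rule someI_ex)
    have s1: "1 \<le> s" and \<eta>0: "0 \<le> \<eta>" using s \<eta> by auto
    have "\<exists>\<sigma>. real J * \<sigma> \<le> 1 \<and> (\<forall>i < j. d (0, 0, 2 * int i) ((0, 0, 2 * int i) \<odot> (0, 0, 2)) \<le> \<sigma>)"
    proof (cases "\<exists>S. 4 * real w * real s + 5 * \<eta> < real (s ^ 2) * v S (0, 0, 0)")
      case True
      then obtain S where fast: "4 * real w * real s + 5 * \<eta> < real (s ^ 2) * v S (0, 0, 0)" ..
      obtain u where u: "\<And>x y. \<lbrakk>x \<in> box w; y \<in> box w\<rbrakk> \<Longrightarrow> \<bar>u x - u y\<bar> \<le> d x y"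
        "\<And>x y. \<lbrakk>x \<in> box w; y \<in> box w\<rbrakk> \<Longrightarrow> d x y \<le> \<bar>u x - u y\<bar> + 3 * \<eta>"
        using fast_line_gives_coordinate[OF w s1 \<eta>0 lines fast] by blast
      let ?\<sigma> = "6 / real r + 24 * real r ^ 2 * \<eta> + 27 * \<eta>"
      have "real J * ?\<sigma> = 6 * real J / real r + 24 * (real J * real r ^ 2 * \<eta>) + 27 * (real J * \<eta>)"
        by (simp add: algebra_simps)
      also have "6 * real J / real r = 1 / 2" using assms by (simp add: r_def)
      finally have "real J * ?\<sigma> \<le> 1" using J\<eta> J\<eta>' by linarith
      moreover have "d (0, 0, 2 * int i) ((0, 0, 2 * int i) \<odot> (0, 0, 2)) \<le> ?\<sigma>" if "i < j" for i
        using central_step[OF w s1 \<eta>0 lines u s r centre_in_box[of i J]] that j by (simp add: w_def)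
      ultimately show ?thesis by blast
    next
      case False
      let ?\<sigma> = "6 * real w / real s + 7 * \<eta>"
      have slow: "d x (x \<odot> axis S 1) \<le> ?\<sigma>" if "x \<in> box w" for S x
        using slow_line_gives_small_steps[OF w s1 \<eta>0 lines _ that] False by (meson not_less)
      have "real J * (4 * ?\<sigma>) = 24 * real J * real w / real s + 28 * (real J * \<eta>)"
        by (simp add: algebra_simps)
      also have "24 * real J * real w / real s = 1 / 2" using assms w by (simp add: s_def)
      finally have "real J * (4 * ?\<sigma>) \<le> 1" using J\<eta>' by linarith
      moreover have "d (0, 0, 2 * int i) ((0, 0, 2 * int i) \<odot> (0, 0, 2)) \<le> 4 * ?\<sigma>" if "i < j" for i
      proof (rule slow_steps_central[OF _ _ slow])
        show "(0, 0, 2 * int i) \<in> box (2 * J)" using that j by (intro centre_in_box) simp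
        show "2 * J + 3 \<le> w" by (simp add: w_def)
      qed
      ultimately show ?thesis by blast
    qed
    then obtain \<sigma> where \<sigma>: "real J * \<sigma> \<le> 1"
      "\<And>i. i < j \<Longrightarrow> d (0, 0, 2 * int i) ((0, 0, 2 * int i) \<odot> (0, 0, 2)) \<le> \<sigma>" by blast
    show "d (0, 0, 0) (0, 0, 2 * int j) \<le> 1"
    proof (cases "j = 0")
      case False
      then have "0 \<le> \<sigma>" using \<sigma>(2)[of 0] d_nonneg order_trans by blast
      then have "real j * \<sigma> \<le> real J * \<sigma>" using j by (intro mult_right_mono) auto
      then show ?thesis using central_chain[OF \<sigma>(2)] \<sigma>(1) by fastforce
    qed simp
  qed
qed

section \<open>A scale at which all lines are almost uniform\<close>

lemma finite_subset_box:
  assumes "finite A"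
  obtains r where "A \<subseteq> box r"
proof -
  have "\<exists>r. A \<subseteq> box r" using assms
  proof (induction A rule: finite_induct)
    case (insert x A)
    then obtain r where r: "A \<subseteq> box r" by blast
    obtain a b c where x: "x = (a, b, c)" by (cases x)
    let ?t = "nat \<bar>a\<bar> + nat \<bar>b\<bar> + nat \<bar>c\<bar>"
    have "nat \<bar>c\<bar> \<le> ?t ^ 2"
      using self_le_power[of ?t 2] by (cases "?t = 0") auto
    then have "\<bar>c\<bar> \<le> int (?t ^ 2)" by (simp only: nat_le_iff)
    then have "x \<in> box ?t" unfolding x box_def mem_Collect_eq case_prod_conv by linarith
    then have "insert x A \<subseteq> box (max r ?t)" using r box_mono[of r "max r ?t"] box_mono[of ?t "max r ?t"] by auto
    then show ?case by blast
  qed simp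
  then show ?thesis using that by blast
qed

text \<open>Right translation by \<open>g\<close> is injective and moves the box of radius
  \<open>n\<close> into the one of radius \<open>n + \<rho>\<close>.\<close>

lemma sum_translate_le:
  assumes "\<And>x. 0 \<le> \<phi> x" "g \<in> box \<rho>"
  shows "(\<Sum>x \<in> box n. \<phi> (x \<odot> g)) \<le> (\<Sum>x \<in> box (n + \<rho>). \<phi> x :: real)"
proof -
  have inj: "inj_on (\<lambda>x. x \<odot> g) (box n)" by (auto simp: inj_on_def hmult_right_cancel)
  have "(\<Sum>x \<in> box n. \<phi> (x \<odot> g)) = (\<Sum>x \<in> (\<lambda>x. x \<odot> g) ` box n. \<phi> x)"
    by (simp add: sum.reindex[OF inj])
  also have "\<dots> \<le> (\<Sum>x \<in> box (n + \<rho>). \<phi> x)"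
    using assms box_mult[OF _ assms(2)] by (intro sum_mono2) (auto simp: finite_box)
  finally show ?thesis .
qed

lemma sum_box_enlarge:
  assumes "\<And>x. \<phi> x \<le> (1::real)" "n \<le> n'"
  shows "(\<Sum>x \<in> box n'. \<phi> x) \<le> (\<Sum>x \<in> box n. \<phi> x) + (real (card (box n')) - real (card (box n)))"
proof -
  have sub: "box n \<subseteq> box n'" by (rule box_mono[OF assms(2)])
  have "(\<Sum>x \<in> box n'. \<phi> x) = (\<Sum>x \<in> box n' - box n. \<phi> x) + (\<Sum>x \<in> box n. \<phi> x)"
    by (rule sum.subset_diff[OF sub finite_box])
  moreover have "(\<Sum>x \<in> box n' - box n. \<phi> x) \<le> real (card (box n' - box n))"
    using sum_mono[of "box n' - box n" \<phi> "\<lambda>_. 1"] assms(1) by simp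
  moreover have "real (card (box n' - box n)) = real (card (box n')) - real (card (box n))"
    using card_Diff_subset[OF finite_box sub] card_mono[OF finite_box sub] by simp
  ultimately show ?thesis by simp
qed

text \<open>Here \<open>\<Delta>\<close> is the drop from scale \<open>k\<close> to scale \<open>k +
  1\<close>. Summed over a nearly translation-invariant box, the drops telescope over \<open>k\<close> to
  at most three times the cardinality of the box, independently of the number \<open>K\<close> of scales.
  Hence, for large \<open>K\<close>, it is impossible that near every point and at every scale some drop
  exceeds \<open>\<epsilon>\<close>. The points \<open>x \<odot> \<nu> k g\<close> are those at which a
  small drop is needed; their number is the same for all scales.\<close>

lemma small_drop_somewhere:
  fixes q :: "'i \<Rightarrow> nat \<Rightarrow> hpoint \<Rightarrow> real" and sh :: "'i \<Rightarrow> nat \<Rightarrow> nat \<Rightarrow> hpoint"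
    and \<nu> :: "nat \<Rightarrow> 'g \<Rightarrow> hpoint" and R :: nat
  defines "\<Delta> \<equiv> \<lambda>\<iota> k x. (\<Sum>j<R. q \<iota> k (x \<odot> sh \<iota> k j)) / real R - q \<iota> (Suc k) x"
  assumes fin: "finite I" "finite N" and R: "1 \<le> R" and \<epsilon>: "0 < \<epsilon>"
    and q: "\<And>\<iota> k x. \<iota> \<in> I \<Longrightarrow> 0 \<le> q \<iota> k x \<and> q \<iota> k x \<le> 1"
    and \<Delta>_nonneg: "\<And>\<iota> k x. \<iota> \<in> I \<Longrightarrow> 0 \<le> \<Delta> \<iota> k x"
  shows "\<exists>k x. \<forall>\<iota> \<in> I. \<forall>g \<in> N. \<Delta> \<iota> k (x \<odot> \<nu> k g) \<le> \<epsilon>"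
proof (rule ccontr)
  assume "\<not> ?thesis"
  then have large: "\<exists>\<iota> \<in> I. \<exists>g \<in> N. \<epsilon> < \<Delta> \<iota> k (x \<odot> \<nu> k g)" for x k
    by (meson not_less)
  define K where "K = nat \<lceil>3 * real (card I) * real (card N) / \<epsilon>\<rceil> + 1"
  have K: "1 \<le> K" "3 * real (card I) * real (card N) < \<epsilon> * real K"
  proof -
    have "3 * real (card I) * real (card N) / \<epsilon> < real K" unfolding K_def by linarith
    then show "3 * real (card I) * real (card N) < \<epsilon> * real K"
      using \<epsilon> by (simp add: pos_divide_less_eq mult.commute)
  qed (simp add: K_def)
  obtain \<rho> where \<rho>: "(\<lambda>(\<iota>, k, j). sh \<iota> k j) ` (I \<times> {..<K} \<times> {..<R}) \<union> (\<lambda>(k, g). \<nu> k g) ` ({..<K} \<times> N) \<subseteq> box \<rho>"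
    using finite_subset_box fin by (metis (no_types) finite_UnI finite_SigmaI finite_imageI finite_lessThan)
  have sh: "sh \<iota> k j \<in> box \<rho>" if "\<iota> \<in> I" "k < K" "j < R" for \<iota> k j using \<rho> that by force
  have \<nu>: "\<nu> k g \<in> box \<rho>" if "g \<in> N" "k < K" for k g using \<rho> that by force
  obtain n where n: "real (card (box (n + 2 * \<rho>))) \<le> (1 + 1 / real K) * real (card (box n))"
    using box_almost_invariant[OF K(1)] .
  define c where "c m = real (card (box m))" for m
  have c0: "0 < c n" using one_in_box finite_box by (auto simp: c_def card_gt_0_iff)
  have c1: "c n \<le> c (n + \<rho>)" "c (n + \<rho>) \<le> c (n + 2 * \<rho>)"
    unfolding c_def by (auto intro!: card_mono finite_box box_mono)
  have c2: "real K * (c (n + 2 * \<rho>) - c n) \<le> c n"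
    using n K(1) unfolding c_def[symmetric] by (simp add: field_simps)
  have c3: "c (n + \<rho>) \<le> 2 * c n"
  proof -
    have "1 * (c (n + 2 * \<rho>) - c n) \<le> real K * (c (n + 2 * \<rho>) - c n)"
      using K(1) c1 by (intro mult_right_mono) auto
    then have "c (n + 2 * \<rho>) - c n \<le> c n" using c2 by simp
    then show ?thesis using c1 by linarith
  qed
  define Q where "Q \<iota> k = (\<Sum>x \<in> box (n + \<rho>). q \<iota> k x)" for \<iota> k
  \<comment> \<open>Translating the terms of the mean by \<open>sh\<close> changes their sum over the box by a boundary term only.\<close>
  have drop: "(\<Sum>x \<in> box (n + \<rho>). \<Delta> \<iota> k x) \<le> Q \<iota> k - Q \<iota> (Suc k) + (c (n + 2 * \<rho>) - c n)"
    if \<iota>: "\<iota> \<in> I" and k: "k < K" for \<iota> k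
  proof -
    have shift: "(\<Sum>x \<in> box (n + \<rho>). q \<iota> k (x \<odot> sh \<iota> k j)) \<le> Q \<iota> k + (c (n + 2 * \<rho>) - c n)"
      if "j < R" for j
    proof -
      have "(\<Sum>x \<in> box (n + \<rho>). q \<iota> k (x \<odot> sh \<iota> k j)) \<le> (\<Sum>x \<in> box (n + \<rho> + \<rho>). q \<iota> k x)"
        using q \<iota> sh[OF \<iota> k that] by (intro sum_translate_le) auto
      also have "\<dots> \<le> Q \<iota> k + (c (n + \<rho> + \<rho>) - c (n + \<rho>))"
        unfolding Q_def c_def using q \<iota> by (intro sum_box_enlarge) auto
      finally show ?thesis using c1 by (simp add: mult_2 add.assoc)
    qed
    have "(\<Sum>x \<in> box (n + \<rho>). \<Delta> \<iota> k x)
        = (\<Sum>j<R. \<Sum>x \<in> box (n + \<rho>). q \<iota> k (x \<odot> sh \<iota> k j)) / real R - Q \<iota> (Suc k)"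
      unfolding \<Delta>_def Q_def sum_subtractf sum_divide_distrib[symmetric] by (subst sum.swap) simp
    moreover have "(\<Sum>j<R. \<Sum>x \<in> box (n + \<rho>). q \<iota> k (x \<odot> sh \<iota> k j))
        \<le> real R * (Q \<iota> k + (c (n + 2 * \<rho>) - c n))"
      using sum_bounded_above[of "{..<R}" "\<lambda>j. \<Sum>x \<in> box (n + \<rho>). q \<iota> k (x \<odot> sh \<iota> k j)"] shift by simp
    then have "(\<Sum>j<R. \<Sum>x \<in> box (n + \<rho>). q \<iota> k (x \<odot> sh \<iota> k j)) / real R
        \<le> Q \<iota> k + (c (n + 2 * \<rho>) - c n)"
      using R by (simp add: pos_divide_le_eq mult.commute)
    ultimately show ?thesis by linarith
  qed
  have total: "(\<Sum>k<K. \<Sum>x \<in> box (n + \<rho>). \<Delta> \<iota> k x) \<le> 3 * c n" if \<iota>: "\<iota> \<in> I" for \<iota>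
  proof -
    have "(\<Sum>k<K. \<Sum>x \<in> box (n + \<rho>). \<Delta> \<iota> k x)
        \<le> (\<Sum>k<K. Q \<iota> k - Q \<iota> (Suc k) + (c (n + 2 * \<rho>) - c n))"
      using drop[OF \<iota>] by (intro sum_mono) auto
    also have "\<dots> = Q \<iota> 0 - Q \<iota> K + real K * (c (n + 2 * \<rho>) - c n)"
      by (simp add: sum.distrib sum_lessThan_telescope')
    finally have "(\<Sum>k<K. \<Sum>x \<in> box (n + \<rho>). \<Delta> \<iota> k x)
        \<le> Q \<iota> 0 - Q \<iota> K + real K * (c (n + 2 * \<rho>) - c n)" .
    moreover have "Q \<iota> 0 \<le> c (n + \<rho>)"
      using sum_mono[of "box (n + \<rho>)" "q \<iota> 0" "\<lambda>_. 1"] q \<iota> by (simp add: Q_def c_def)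
    moreover have "0 \<le> Q \<iota> K" using q \<iota> by (auto simp: Q_def intro: sum_nonneg)
    ultimately show ?thesis using c2 c3 by linarith
  qed
  have "real K * c n * \<epsilon> = (\<Sum>k<K. \<Sum>x \<in> box n. \<epsilon>)" by (simp add: c_def)
  also have "\<dots> \<le> (\<Sum>k<K. \<Sum>x \<in> box n. \<Sum>\<iota> \<in> I. \<Sum>g \<in> N. \<Delta> \<iota> k (x \<odot> \<nu> k g))"
  proof (intro sum_mono)
    fix k x
    obtain \<iota> g where g: "\<iota> \<in> I" "g \<in> N" "\<epsilon> < \<Delta> \<iota> k (x \<odot> \<nu> k g)" using large by blast
    have "\<epsilon> \<le> (\<Sum>g \<in> N. \<Delta> \<iota> k (x \<odot> \<nu> k g))"
      using g fin(2) \<Delta>_nonneg member_le_sum[of g N "\<lambda>g. \<Delta> \<iota> k (x \<odot> \<nu> k g)"] by fastforce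
    also have "\<dots> \<le> (\<Sum>\<iota> \<in> I. \<Sum>g \<in> N. \<Delta> \<iota> k (x \<odot> \<nu> k g))"
      using g(1) fin(1) by (intro member_le_sum sum_nonneg \<Delta>_nonneg) auto
    finally show "\<epsilon> \<le> (\<Sum>\<iota> \<in> I. \<Sum>g \<in> N. \<Delta> \<iota> k (x \<odot> \<nu> k g))" .
  qed
  also have "\<dots> = (\<Sum>\<iota> \<in> I. \<Sum>k<K. \<Sum>g \<in> N. \<Sum>x \<in> box n. \<Delta> \<iota> k (x \<odot> \<nu> k g))"
    by (subst sum.swap[of _ _ I], subst sum.swap[of _ I], rule sum.cong[OF refl],
        rule sum.cong[OF refl], rule sum.swap)
  also have "\<dots> \<le> (\<Sum>\<iota> \<in> I. \<Sum>k<K. \<Sum>g \<in> N. \<Sum>x \<in> box (n + \<rho>). \<Delta> \<iota> k x)"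
    using \<nu> \<Delta>_nonneg by (intro sum_mono sum_translate_le) auto
  also have "\<dots> = (\<Sum>\<iota> \<in> I. real (card N) * (\<Sum>k<K. \<Sum>x \<in> box (n + \<rho>). \<Delta> \<iota> k x))"
    by (simp add: sum_distrib_left)
  also have "\<dots> \<le> (\<Sum>\<iota> \<in> I. real (card N) * (3 * c n))"
    using total by (intro sum_mono mult_left_mono) auto
  also have "\<dots> = 3 * real (card I) * real (card N) * c n" by simp
  also have "\<dots> < \<epsilon> * real K * c n" using K(2) c0 by (rule mult_strict_right_mono)
  finally show False by (simp add: mult_ac)
qed

text \<open>Write \<open>x\<^sub>j\<close> for the length of the \<open>j\<close>-th step,
  \<open>s\<close> for their sum and \<open>D\<close> for the distance of the endpoints. The defect splits
  into \<open>R \<Sum> x\<^sub>j\<^sup>2 - s\<^sup>2\<close>, which is \<open>R\<close> times the sum of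
  the squared deviations from the mean, and \<open>s\<^sup>2 - D\<^sup>2 \<ge> (s - D)\<^sup>2\<close>.
  Both are nonnegative, so a small defect makes all steps nearly equal and the path nearly
  geodesic.\<close>

lemma small_defect_uniform:
  fixes d :: "'p \<Rightarrow> 'p \<Rightarrow> real" and p :: "nat \<Rightarrow> 'p"
  assumes self: "\<And>x. d x x = 0" and sym: "\<And>x y. d x y = d y x"
    and tri: "\<And>x y z. d x z \<le> d x y + d y z"
    and R: "1 \<le> R" and \<zeta>: "0 \<le> \<zeta>"
    and defect: "real R * (\<Sum>j<R. d (p j) (p (Suc j)) ^ 2) - d (p 0) (p R) ^ 2 \<le> \<zeta> ^ 2"
  shows "\<exists>v. \<forall>i j. i \<le> j \<and> j \<le> R \<longrightarrow> \<bar>d (p i) (p j) - real (j - i) * v\<bar> \<le> (real R + 1) * \<zeta>"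
proof -
  define x where "x j = d (p j) (p (Suc j))" for j
  define s where "s = (\<Sum>j<R. x j)"
  define D where "D = d (p 0) (p R)"
  have chain: "d (p i) (p j) \<le> (\<Sum>l=i..<j. x l)" if "i \<le> j" for i j
    using that
  proof (induction j rule: dec_induct)
    case (step j)
    then show ?case using tri[of "p i" "p (Suc j)" "p j"] by (simp add: x_def)
  qed (simp add: self)
  have nonneg: "0 \<le> d a b" for a b using tri[of a a b] sym[of a b] self[of a] by simp
  have sD: "D \<le> s" using chain[of 0 R] by (simp add: D_def s_def atLeast0LessThan)
  have D0: "0 \<le> D" by (simp add: D_def nonneg)
  have variance: "real R * (\<Sum>j<R. (x j - s / real R) ^ 2) = real R * (\<Sum>j<R. x j ^ 2) - s ^ 2"
  proof -
    have "(\<Sum>j<R. (x j - s / real R) ^ 2)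
        = (\<Sum>j<R. x j ^ 2) - 2 * (s / real R) * s + real R * (s / real R) ^ 2"
    proof -
      define \<mu> where "\<mu> = s / real R"
      have "(x j - \<mu>) ^ 2 = x j ^ 2 - 2 * \<mu> * x j + \<mu> ^ 2" for j
        by (simp add: power2_diff)
      then have "(\<Sum>j<R. (x j - \<mu>) ^ 2) = (\<Sum>j<R. x j ^ 2) - 2 * \<mu> * s + real R * \<mu> ^ 2"
        by (simp add: s_def sum.distrib sum_subtractf flip: sum_distrib_left)
      then show ?thesis by (simp add: \<mu>_def)
    qed
    then show ?thesis using R by (simp add: field_simps power2_eq_square)
  qed
  have def: "real R * (\<Sum>j<R. x j ^ 2) - D ^ 2 \<le> \<zeta> ^ 2"
    using defect by (simp add: x_def D_def)
  have var_nonneg: "0 \<le> real R * (\<Sum>j<R. (x j - s / real R) ^ 2)"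
    by (intro mult_nonneg_nonneg sum_nonneg) auto
  have gap: "s - D \<le> \<zeta>"
  proof -
    have "(s - D) ^ 2 \<le> s ^ 2 - D ^ 2"
      using mult_left_mono[OF sD D0] by (simp add: power2_eq_square algebra_simps)
    also have "\<dots> \<le> \<zeta> ^ 2" using variance var_nonneg def by linarith
    finally show ?thesis using \<zeta> by (rule power2_le_imp_le)
  qed
  have speed: "\<bar>x j - s / real R\<bar> \<le> \<zeta>" if "j < R" for j
  proof -
    have "(x j - s / real R) ^ 2 \<le> (\<Sum>j<R. (x j - s / real R) ^ 2)"
      using that by (intro member_le_sum) auto
    also have "\<dots> \<le> real R * (\<Sum>j<R. (x j - s / real R) ^ 2)"
      using R mult_right_mono[of 1 "real R" "\<Sum>j<R. (x j - s / real R) ^ 2"] by (simp add: sum_nonneg)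
    also have "\<dots> \<le> \<zeta> ^ 2"
      using variance def power_mono[OF sD D0, of 2] by linarith
    finally show ?thesis using \<zeta> abs_le_square_iff[of "x j - s / real R" \<zeta>] by simp
  qed
  show ?thesis
  proof (intro exI[of _ "s / real R"] allI impI, elim conjE)
    fix i j assume ij: "i \<le> j" "j \<le> R"
    let ?m = "s / real R"
    have "(\<Sum>l=i..<j. x l) - real (j - i) * ?m = (\<Sum>l=i..<j. x l - ?m)"
      by (simp add: sum_subtractf)
    moreover have "\<bar>\<Sum>l=i..<j. x l - ?m\<bar> \<le> (\<Sum>l=i..<j. \<zeta>)"
      using ij speed by (intro order_trans[OF sum_abs] sum_mono) auto
    ultimately have mid: "\<bar>(\<Sum>l=i..<j. x l) - real (j - i) * ?m\<bar> \<le> real (j - i) * \<zeta>" by simp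
    have "s = (\<Sum>l=0..<i. x l) + (\<Sum>l=i..<j. x l) + (\<Sum>l=j..<R. x l)"
      using ij by (simp add: s_def sum.atLeastLessThan_concat flip: atLeast0LessThan)
    moreover have "D \<le> d (p 0) (p i) + d (p i) (p j) + d (p j) (p R)"
      using tri[of "p 0" "p R" "p i"] tri[of "p i" "p R" "p j"] by (simp add: D_def)
    ultimately have low: "(\<Sum>l=i..<j. x l) - \<zeta> \<le> d (p i) (p j)"
      using chain[of 0 i] chain[of j R] ij gap by simp
    have "real (j - i) * \<zeta> \<le> real R * \<zeta>" using ij \<zeta> by (intro mult_right_mono) auto
    then show "\<bar>d (p i) (p j) - real (j - i) * ?m\<bar> \<le> (real R + 1) * \<zeta>"
      using mid low chain[OF ij(1)] \<zeta> by (simp add: algebra_simps)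
  qed
qed

definition dilate :: "nat \<Rightarrow> hpoint \<Rightarrow> hpoint" where
  "dilate m = (\<lambda>(a, b, c). (int m * a, int m * b, int m ^ 2 * c))"

lemma dilate_mult: "dilate m (x \<odot> y) = dilate m x \<odot> dilate m y"
  by (cases x; cases y) (simp add: dilate_def mult_heisenberg algebra_simps power2_eq_square)

lemma dilate_axis: "dilate m (axis S n) = axis S (int m * n)"
  by (simp add: dilate_def axis_def)

lemma dilate_box:
  assumes "g \<in> box t"
  shows "dilate m g \<in> box (m * t)"
proof -
  obtain a b c where g: "g = (a, b, c)" by (cases g)
  have b: "\<bar>a\<bar> \<le> int t" "\<bar>b\<bar> \<le> int t" "\<bar>c\<bar> \<le> int t ^ 2" using assms by (auto simp: g box_def)
  have "\<bar>int m * a\<bar> \<le> int m * int t" "\<bar>int m * b\<bar> \<le> int m * int t"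
    "\<bar>int m ^ 2 * c\<bar> \<le> int m ^ 2 * int t ^ 2"
    unfolding abs_mult using b by (auto intro!: mult_mono)
  then show ?thesis by (simp add: g dilate_def box_def power_mult_distrib)
qed

lemma rescaled_hyperbolic_lipschitz:
  assumes "hyperbolic_lipschitz d" and m: "1 \<le> m"
  shows "hyperbolic_lipschitz (\<lambda>g h. d (x \<odot> dilate m g) (x \<odot> dilate m h) / real m)"
proof -
  interpret hyperbolic_lipschitz d by fact
  show ?thesis
  proof
    fix a b c e :: hpoint
    show "d (x \<odot> dilate m a) (x \<odot> dilate m a) / real m = 0" by simp
    show "d (x \<odot> dilate m a) (x \<odot> dilate m b) / real m = d (x \<odot> dilate m b) (x \<odot> dilate m a) / real m"
      by (simp add: d_sym)
    show "d (x \<odot> dilate m a) (x \<odot> dilate m c) / real m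
        \<le> d (x \<odot> dilate m a) (x \<odot> dilate m b) / real m + d (x \<odot> dilate m b) (x \<odot> dilate m c) / real m"
      unfolding add_divide_distrib[symmetric] by (intro divide_right_mono d_tri) simp
    show "d (x \<odot> dilate m a) (x \<odot> dilate m b) / real m + d (x \<odot> dilate m c) (x \<odot> dilate m e) / real m
        \<le> max (d (x \<odot> dilate m a) (x \<odot> dilate m c) / real m + d (x \<odot> dilate m b) (x \<odot> dilate m e) / real m)
           (d (x \<odot> dilate m a) (x \<odot> dilate m e) / real m + d (x \<odot> dilate m b) (x \<odot> dilate m c) / real m)"
      using divide_right_mono[OF d_four_point[of "x \<odot> dilate m a" "x \<odot> dilate m b" "x \<odot> dilate m c" "x \<odot> dilate m e"],
          of "real m"]
      by (simp add: add_divide_distrib max_divide_distrib_right)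
  next
    fix g t y assume "g \<in> box t"
    then have "d (x \<odot> dilate m y) (x \<odot> dilate m y \<odot> dilate m g) \<le> real (m * t)"
      by (intro d_box dilate_box)
    then show "d (x \<odot> dilate m y) (x \<odot> dilate m (y \<odot> g)) / real m \<le> real t"
      using m by (simp add: dilate_mult hmult_assoc pos_divide_le_eq mult.commute)
  qed
qed

text \<open>Lines of \<open>R = 2 s\<^sup>2\<close> steps are needed, so the scales are the powers of
  \<open>R\<close>. The drop of \<open>q\<close> at scale \<open>R\<^sup>k\<close> is the defect of a line
  with steps of length \<open>R\<^sup>k\<close> (up to normalisation), and it is made small at the
  starting points of all lines through the dilated box of radius \<open>w\<close>.\<close>

lemma collapsing_scale:
  fixes d :: "'i \<Rightarrow> hpoint \<Rightarrow> hpoint \<Rightarrow> real"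
  assumes I: "finite I" and hyp: "\<And>i. i \<in> I \<Longrightarrow> hyperbolic_lipschitz (d i)" and J: "1 \<le> J"
  shows "\<exists>x m. 1 \<le> m \<and> (\<forall>i \<in> I. \<forall>j \<le> J. d i x (x \<odot> (0, 0, 2 * int m ^ 2 * int j)) \<le> real m)"
proof (rule uniform_lines_collapse_centre[OF J])
  fix w s :: nat and \<eta> :: real
  assume \<eta>: "0 < \<eta>" and s: "1 \<le> s" and
    collapse: "\<And>d j. \<lbrakk>hyperbolic_lipschitz d;
       \<And>S y. y \<in> box w \<Longrightarrow> \<exists>v. hyperbolic_lipschitz.uniform_line d (s ^ 2) \<eta> S y v; j \<le> J\<rbrakk>
       \<Longrightarrow> d (0, 0, 0) (0, 0, 2 * int j) \<le> 1"
  define R where "R = 2 * s ^ 2"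
  have R: "1 \<le> R" using s by (simp add: R_def Suc_le_eq)
  define \<zeta> where "\<zeta> = \<eta> / (real R + 1)"
  have \<zeta>: "0 < \<zeta>" using \<eta> by (simp add: \<zeta>_def add_nonneg_pos)
  define q where "q = (\<lambda>(i, S) k x. (d i x (x \<odot> axis S (int R ^ k)) / real R ^ k) ^ 2)"
  define sh where "sh = (\<lambda>(i :: 'i, S) k j. axis S (int R ^ k * int j))"
  let ?\<Delta> = "\<lambda>\<iota> k x. (\<Sum>j<R. q \<iota> k (x \<odot> sh \<iota> k j)) / real R - q \<iota> (Suc k) x"
  have \<Delta>_eq: "?\<Delta> (i, S) k x =
      (real R * (\<Sum>j<R. (d i (x \<odot> axis S (int R ^ k * int j)) (x \<odot> axis S (int R ^ k * int (Suc j))) / real R ^ k) ^ 2)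
        - (d i x (x \<odot> axis S (int R ^ k * int R)) / real R ^ k) ^ 2) / real R ^ 2" for i S k x
  proof -
    have "x \<odot> axis S (int R ^ k * int j) \<odot> axis S (int R ^ k) = x \<odot> axis S (int R ^ k * int (Suc j))" for j
      by (simp add: axis_add' algebra_simps)
    then show ?thesis using R
      by (simp add: q_def sh_def field_simps power2_eq_square)
  qed
  have q01: "0 \<le> q \<iota> k x \<and> q \<iota> k x \<le> 1" if mem: "\<iota> \<in> I \<times> UNIV" for \<iota> k x
  proof -
    obtain i S where \<iota>: "\<iota> = (i, S)" "i \<in> I" using mem by blast
    interpret hyperbolic_lipschitz "d i" by (rule hyp[OF \<iota>(2)])
    have "d i x (x \<odot> axis S (int R ^ k)) \<le> real (R ^ k)"
      by (intro d_box axis_in_box) simp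
    then have "d i x (x \<odot> axis S (int R ^ k)) / real R ^ k \<le> 1" using R by simp
    then show ?thesis using d_nonneg by (simp add: q_def \<iota>(1) power_le_one)
  qed
  have \<Delta>_nonneg: "0 \<le> ?\<Delta> \<iota> k x" if mem: "\<iota> \<in> I \<times> UNIV" for \<iota> k x
  proof -
    obtain i S where \<iota>: "\<iota> = (i, S)" "i \<in> I" using mem by blast
    interpret hyperbolic_lipschitz "d i" by (rule hyp[OF \<iota>(2)])
    let ?p = "\<lambda>j. x \<odot> axis S (int R ^ k * int j)"
    let ?x = "\<lambda>j. d i (?p j) (?p (Suc j)) / real R ^ k"
    have "d i (?p 0) (?p n) \<le> (\<Sum>j<n. d i (?p j) (?p (Suc j)))" for n
    proof (induction n)
      case (Suc n)
      then show ?case using d_tri[of "?p 0" "?p (Suc n)" "?p n"] by simp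
    qed simp
    then have "d i x (?p R) / real R ^ k \<le> (\<Sum>j<R. ?x j)"
      unfolding sum_divide_distrib[symmetric] by (intro divide_right_mono) (auto simp del: of_nat_Suc)
    then have "(d i x (?p R) / real R ^ k) ^ 2 \<le> (\<Sum>j<R. ?x j) ^ 2"
      using d_nonneg by (intro power_mono) (auto simp del: of_nat_Suc)
    also have "\<dots> \<le> (\<Sum>j<R. ?x j ^ 2) * real (card {..<R})"
      by (rule sum_squared_le_sum_of_squares)
    finally show ?thesis unfolding \<iota>(1) \<Delta>_eq by (simp add: mult.commute del: of_nat_Suc)
  qed
  have fin: "finite (I \<times> (UNIV :: bool set))" and \<epsilon>: "0 < \<zeta> ^ 2 / real R ^ 2"
    using I \<zeta> R by auto
  have "\<exists>k x. \<forall>\<iota> \<in> I \<times> UNIV. \<forall>g \<in> box (w + s ^ 2).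
      ?\<Delta> \<iota> k (x \<odot> dilate (R ^ k) g) \<le> \<zeta> ^ 2 / real R ^ 2"
    by (rule small_drop_somewhere[where q = q and sh = sh and \<nu> = "\<lambda>k. dilate (R ^ k)",
        OF fin finite_box[of "w + s ^ 2"] R \<epsilon>]) (erule q01, erule \<Delta>_nonneg)
  then obtain k x where "\<forall>\<iota> \<in> I \<times> UNIV. \<forall>g \<in> box (w + s ^ 2).
      ?\<Delta> \<iota> k (x \<odot> dilate (R ^ k) g) \<le> \<zeta> ^ 2 / real R ^ 2" by (elim exE)
  note xk = this[rule_format]
  define m where "m = R ^ k"
  have m: "1 \<le> m" using R by (simp add: m_def)
  show ?thesis
  proof (intro exI[of _ x] exI[of _ m] conjI m ballI allI impI)
    fix i j assume i: "i \<in> I" and j: "j \<le> J"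
    let ?d = "\<lambda>g h. d i (x \<odot> dilate m g) (x \<odot> dilate m h) / real m"
    interpret D: hyperbolic_lipschitz ?d by (rule rescaled_hyperbolic_lipschitz[OF hyp[OF i] m])
    have "\<exists>v. D.uniform_line (s ^ 2) \<eta> S y v" if y: "y \<in> box w" for S y
    proof -
      let ?g = "y \<odot> axis S (- int (s ^ 2))"
      define p where "p j = ?g \<odot> axis S (int j)" for j :: nat
      have "?g \<in> box (w + s ^ 2)" by (intro box_mult y axis_in_box) simp
      then have "?\<Delta> (i, S) k (x \<odot> dilate (R ^ k) ?g) \<le> \<zeta> ^ 2 / real R ^ 2"
        using i by (intro xk) auto
      then have "(real R * (\<Sum>j<R. (d i (x \<odot> dilate (R ^ k) ?g \<odot> axis S (int R ^ k * int j))
            (x \<odot> dilate (R ^ k) ?g \<odot> axis S (int R ^ k * int (Suc j))) / real R ^ k) ^ 2)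
          - (d i (x \<odot> dilate (R ^ k) ?g) (x \<odot> dilate (R ^ k) ?g \<odot> axis S (int R ^ k * int R)) / real R ^ k) ^ 2)
          / real R ^ 2 \<le> \<zeta> ^ 2 / real R ^ 2"
        unfolding \<Delta>_eq .
      moreover have "x \<odot> dilate m (p j) = x \<odot> dilate (R ^ k) ?g \<odot> axis S (int R ^ k * int j)" for j
        by (simp add: p_def dilate_mult dilate_axis hmult_assoc m_def)
      moreover have "p 0 = ?g" by (simp add: p_def)
      ultimately have defect: "real R * (\<Sum>j<R. ?d (p j) (p (Suc j)) ^ 2) - ?d (p 0) (p R) ^ 2 \<le> \<zeta> ^ 2"
        using R by (simp add: m_def divide_le_cancel del: of_nat_Suc)
      obtain v where v: "\<forall>i j. i \<le> j \<and> j \<le> R \<longrightarrow> \<bar>?d (p i) (p j) - real (j - i) * v\<bar> \<le> (real R + 1) * \<zeta>"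
        using small_defect_uniform[where d = ?d, OF D.d_self D.d_sym D.d_tri R less_imp_le[OF \<zeta>] defect] by (elim exE)
      have "D.uniform_line (s ^ 2) \<eta> S y v"
        unfolding D.uniform_line_def
      proof (intro allI impI, elim conjE)
        fix a b assume ab: "- int (s ^ 2) \<le> a" "a \<le> b" "b \<le> int (s ^ 2)"
        define a' b' where "a' = nat (a + int (s ^ 2))" and "b' = nat (b + int (s ^ 2))"
        have "p a' = y \<odot> axis S a" "p b' = y \<odot> axis S b"
          using ab by (simp_all add: p_def a'_def b'_def axis_add')
        moreover have "a' \<le> b'" "b' \<le> R" "real (b' - a') = of_int (b - a)"
          using ab by (auto simp: a'_def b'_def R_def nat_le_iff)
        moreover have "(real R + 1) * \<zeta> = \<eta>" by (simp add: \<zeta>_def add_nonneg_eq_0_iff)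
        ultimately show "\<bar>?d (y \<odot> axis S a) (y \<odot> axis S b) - of_int (b - a) * v\<bar> \<le> \<eta>"
          using v[rule_format, of a' b'] by simp
      qed
      then show ?thesis ..
    qed
    then have "?d (0, 0, 0) (0, 0, 2 * int j) \<le> 1"
      by (intro collapse[OF D.hyperbolic_lipschitz_axioms _ j])
    then show "d i x (x \<odot> (0, 0, 2 * int m ^ 2 * int j)) \<le> real m"
      using m by (simp add: dilate_def mult_ac)
  qed
qed

section \<open>Lipschitz maps from the Heisenberg group to trees\<close>

text \<open>When every generator costs at most 1, an element of a box of radius \<open>t\<close> costs at most \<open>8 t\<close>:
  horizontal moves account for \<open>2 t\<close> and the central coordinate for \<open>6 t\<close>.\<close>

context
  fixes D :: "hpoint \<Rightarrow> hpoint \<Rightarrow> real"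
  assumes self: "\<And>x. D x x = 0"
    and tri: "\<And>x y z. D x z \<le> D x y + D y z"
    and step: "\<And>x s. s \<in> heisenberg_gens \<Longrightarrow> D x (x \<odot> s) \<le> 1"
begin

lemma one_parameter_bound:
  assumes add: "\<And>i j. c i \<odot> c j = c (i + j)" and zero: "c 0 = (0, 0, 0)"
    and gens: "c 1 \<in> heisenberg_gens" "c (-1) \<in> heisenberg_gens"
  shows "D y (y \<odot> c n) \<le> of_int \<bar>n\<bar>"
proof -
  have "D y (y \<odot> c (\<sigma> * int k)) \<le> real k" if \<sigma>: "\<sigma> \<in> {1, -1}" for \<sigma> k
  proof (induction k)
    case 0
    then show ?case by (simp add: zero self)
  next
    case (Suc k)
    have "y \<odot> c (\<sigma> * int k) \<odot> c \<sigma> = y \<odot> c (\<sigma> * int (Suc k))"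
      by (simp add: hmult_assoc add algebra_simps)
    moreover have "c \<sigma> \<in> heisenberg_gens" using \<sigma> gens by auto
    ultimately have "D (y \<odot> c (\<sigma> * int k)) (y \<odot> c (\<sigma> * int (Suc k))) \<le> 1" using step by metis
    then show ?case using Suc tri[of y "y \<odot> c (\<sigma> * int (Suc k))" "y \<odot> c (\<sigma> * int k)"] by simp
  qed
  from this[of 1 "nat n"] this[of "-1" "nat (- n)"] show ?thesis by (cases "0 \<le> n") auto
qed

lemma axis_bound: "D y (y \<odot> axis S n) \<le> of_int \<bar>n\<bar>"
  by (rule one_parameter_bound) (auto simp: axis_def mult_heisenberg heisenberg_gens_def)

lemma vertical_bound: "D y (y \<odot> (0, 0, n)) \<le> of_int \<bar>n\<bar>"
  by (rule one_parameter_bound[where c = "\<lambda>n. (0, 0, n)"]) (auto simp: mult_heisenberg heisenberg_gens_def)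

text \<open>The central distance grows like a square root. Division by \<open>2 t\<close> writes
  \<open>k\<close> as \<open>2 t q + u\<close>, where the first part is a commutator of powers of the
  generators and the remainder is climbed step by step.\<close>

lemma centre_bound:
  assumes "\<bar>k\<bar> \<le> 2 * int t ^ 2"
  shows "D y (y \<odot> (0, 0, k)) \<le> 6 * real t"
proof (cases "t = 0")
  case True
  then show ?thesis using assms vertical_bound[of y k] by simp
next
  case False
  define q where "q = k div (2 * int t)"
  define u where "u = k mod (2 * int t)"
  have k: "k = 2 * int t * q + u" by (simp add: q_def u_def)
  have u: "0 \<le> u" "u < 2 * int t" using False by (simp_all add: u_def)
  have q: "\<bar>q\<bar> \<le> int t"
  proof (rule ccontr)
    assume "\<not> \<bar>q\<bar> \<le> int t"
    then consider "int t + 1 \<le> q" | "q \<le> - int t - 1" by linarith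
    then show False
    proof cases
      case 1
      then have "2 * int t * (int t + 1) \<le> 2 * int t * q" by (intro mult_left_mono) auto
      then show False using assms k u False by (simp add: power2_eq_square algebra_simps)
    next
      case 2
      then have "2 * int t * q \<le> 2 * int t * (- int t - 1)" by (intro mult_left_mono) auto
      then show False using assms k u by (simp add: power2_eq_square algebra_simps)
    qed
  qed
  \<comment> \<open>The commutator of \<open>a\<^sup>t\<close> and \<open>b\<^sup>q\<close> climbs \<open>2 t q\<close> at a cost of \<open>2 t + 2 |q|\<close>.\<close>
  let ?y1 = "y \<odot> axis True (int t)"
  let ?y2 = "?y1 \<odot> axis False q"
  let ?y3 = "?y2 \<odot> axis True (- int t)"
  let ?y4 = "?y3 \<odot> axis False (- q)"
  have "?y4 \<odot> (0, 0, u) = y \<odot> (0, 0, k)"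
    by (cases y) (simp add: k axis_def mult_heisenberg algebra_simps)
  moreover have "D y (?y4 \<odot> (0, 0, u)) \<le> D y ?y1 + D ?y1 ?y2 + D ?y2 ?y3 + D ?y3 ?y4 + D ?y4 (?y4 \<odot> (0, 0, u))"
    using tri[of y "?y4 \<odot> (0, 0, u)" ?y4] tri[of y ?y4 ?y3] tri[of y ?y3 ?y2] tri[of y ?y2 ?y1] by linarith
  moreover have "D y ?y1 \<le> real t" "D ?y1 ?y2 \<le> of_int \<bar>q\<bar>" "D ?y2 ?y3 \<le> real t" "D ?y3 ?y4 \<le> of_int \<bar>q\<bar>"
    "D ?y4 (?y4 \<odot> (0, 0, u)) \<le> of_int \<bar>u\<bar>"
    using axis_bound[of y True "int t"] axis_bound[of ?y1 False q] axis_bound[of ?y2 True "- int t"]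
      axis_bound[of ?y3 False "- q"] vertical_bound[of ?y4 u] by simp_all
  moreover have "real_of_int \<bar>q\<bar> \<le> real t" "real_of_int \<bar>u\<bar> \<le> 2 * real t" using q u by linarith+
  ultimately show ?thesis by simp
qed

lemma box_bound:
  assumes "g \<in> box t"
  shows "D y (y \<odot> g) \<le> 8 * real t"
proof -
  obtain i j k where g: "g = (i, j, k)" by (cases g)
  have b: "\<bar>i\<bar> \<le> int t" "\<bar>j\<bar> \<le> int t" "\<bar>k\<bar> \<le> int t ^ 2" using assms by (auto simp: g box_def)
  have "\<bar>i * j\<bar> \<le> int t * int t" unfolding abs_mult using b by (intro mult_mono) auto
  then have k: "\<bar>k - i * j\<bar> \<le> 2 * int t ^ 2" using b(3) by (simp add: power2_eq_square)
  let ?y1 = "y \<odot> axis True i"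
  let ?y2 = "?y1 \<odot> axis False j"
  have "?y2 \<odot> (0, 0, k - i * j) = y \<odot> g"
    by (cases y) (simp add: g axis_def mult_heisenberg algebra_simps)
  moreover have "D y ?y1 \<le> real t" "D ?y1 ?y2 \<le> real t"
    using axis_bound[of y True i] axis_bound[of ?y1 False j] b by linarith+
  moreover have "D ?y2 (?y2 \<odot> (0, 0, k - i * j)) \<le> 6 * real t" by (rule centre_bound[OF k])
  ultimately show ?thesis
    using tri[of y "y \<odot> g" ?y2] tri[of y ?y2 ?y1] by simp
qed

end

lemma lipschitz_to_tree:
  assumes F: "tree F" and V: "\<And>x. \<psi> x \<in> vertices F"
    and adj: "\<And>x s. s \<in> heisenberg_gens \<Longrightarrow> \<psi> x = \<psi> (x \<odot> s) \<or> adjacent F (\<psi> x) (\<psi> (x \<odot> s))"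
  shows "hyperbolic_lipschitz (\<lambda>x y. real (tdist F (\<psi> x) (\<psi> y)) / 8)"
proof
  let ?D = "\<lambda>x y. real (tdist F (\<psi> x) (\<psi> y))"
  fix x y z u v :: hpoint
  show "?D x x / 8 = 0" using tdist_self[OF F V] by simp
  show "?D x y / 8 = ?D y x / 8" using tdist_commute[OF F V V] by simp
  have tri: "?D x z \<le> ?D x y + ?D y z" for x y z using tdist_triangle[OF F V V V, of x z y] by linarith
  then show "?D x z / 8 \<le> ?D x y / 8 + ?D y z / 8" by (simp add: add_divide_distrib[symmetric] divide_right_mono)
  show "?D u v / 8 + ?D x y / 8 \<le> max (?D u x / 8 + ?D v y / 8) (?D u y / 8 + ?D v x / 8)"
    using four_point[OF F V V V V, of u v x y] by linarith
  fix g t assume g: "g \<in> box t"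
  have "?D y (y \<odot> g) \<le> 8 * real t"
  proof (rule box_bound[OF _ tri _ g])
    show "?D x x = 0" for x using tdist_self[OF F V] by simp
    show "?D x (x \<odot> s) \<le> 1" if "s \<in> heisenberg_gens" for x s
      using tdist_adjacent_le[OF F V V adj[OF that]] by simp
  qed
  then show "?D y (y \<odot> g) / 8 \<le> real t" by simp
qed

section \<open>Counting\<close>

lemma tree_ball_bound:
  assumes "tree F" "v \<in> vertices F" "growth F r \<le> enat n"
  shows "finite {w \<in> vertices F. tdist F v w \<le> r}" "card {w \<in> vertices F. tdist F v w \<le> r} \<le> n"
proof -
  have eq: "{w \<in> vertices F. tdist F v w \<le> r} = graph_ball F v r"
    using graph_dist_eq_tdist[OF assms(1,2)] by (auto simp: graph_ball_def)
  have "ecard (graph_ball F v r) \<le> growth F r"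
    unfolding growth_def using assms(2) by (rule SUP_upper)
  then have "ecard (graph_ball F v r) \<le> enat n" using assms(3) by (rule order_trans)
  then show "finite {w \<in> vertices F. tdist F v w \<le> r}" "card {w \<in> vertices F. tdist F v w \<le> r} \<le> n"
    unfolding eq by (auto simp: ecard_def split: if_splits)
qed

text \<open>Central heights \<open>2 m\<^sup>2 j + r\<close> with \<open>r < m\<^sup>2\<close> determine
  \<open>j\<close> and \<open>r\<close>.\<close>

lemma card_column:
  assumes "1 \<le> m"
  shows "card ((\<lambda>(p, q, r, j). x \<odot> (0, 0, 2 * int m ^ 2 * int j) \<odot> (int p, int q, int r))
    ` ({..<m} \<times> {..<m} \<times> {..<m ^ 2} \<times> {..<J})) = m ^ 4 * J"
proof -
  have "inj_on (\<lambda>(p, q, r, j). x \<odot> (0, 0, 2 * int m ^ 2 * int j) \<odot> (int p, int q, int r))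
      ({..<m} \<times> {..<m} \<times> {..<m ^ 2} \<times> {..<J})"
  proof (rule inj_onI, clarify, goal_cases)
    case (1 p q r j p' q' r' j')
    then have "(0, 0, 2 * int m ^ 2 * int j) \<odot> (int p, int q, int r)
        = (0, 0, 2 * int m ^ 2 * int j') \<odot> (int p', int q', int r')"
      by (simp add: hmult_assoc hmult_left_cancel)
    then have pq: "p = p'" "q = q'" and "2 * int m ^ 2 * int j + int r = 2 * int m ^ 2 * int j' + int r'"
      by (simp_all add: mult_heisenberg)
    then have "int (2 * m ^ 2 * j + r) = int (2 * m ^ 2 * j' + r')" by simp
    then have e: "2 * m ^ 2 * j + r = 2 * m ^ 2 * j' + r'" by (simp only: of_nat_eq_iff)
    have "r < 2 * m ^ 2" "r' < 2 * m ^ 2" using 1 by auto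
    then have "j = j'" "r = r'"
      using arg_cong[OF e, of "\<lambda>n. n div (2 * m ^ 2)"] arg_cong[OF e, of "\<lambda>n. n mod (2 * m ^ 2)"] assms by simp_all
    then show ?case using pq by simp
  qed
  then show ?thesis
    by (simp add: card_image card_cartesian_product power2_eq_square power4_eq_xxxx mult.assoc)
qed

text \<open>The hypothesis allows equality so that the lemma can be iterated over the nested
  product.\<close>

lemma strong_product_step:
  assumes "p = q \<or> adjacent (G \<times>\<^sub>s H) p q"
  shows "fst p = fst q \<or> adjacent G (fst p) (fst q)" "snd p = snd q \<or> adjacent H (snd p) (snd q)"
proof (atomize (full), cases "p = q")
  case False
  obtain u1 u2 v1 v2 where e: "{p, q} = {(u1, u2), (v1, v2)}"
    and uv: "u1 = v1 \<or> adjacent G u1 v1" "u2 = v2 \<or> adjacent H u2 v2"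
    using assms False unfolding adjacent_def strong_product_def by auto
  then show "(fst p = fst q \<or> adjacent G (fst p) (fst q)) \<and> (snd p = snd q \<or> adjacent H (snd p) (snd q))"
    unfolding doubleton_eq_iff by (auto simp: adjacent_commute)
qed simp

lemma subgraph_adjacent: "subgraph H G \<Longrightarrow> adjacent H u v \<Longrightarrow> adjacent G u v"
  by (auto simp: subgraph_def adjacent_def)

text \<open>A column of \<open>J\<close> translated boxes over a collapsing centre has more points than
  its image can hold. The factor \<open>16 = 8 + 8\<close> comes from the Lipschitz constant 8 of
  \<open>lipschitz_to_tree\<close>: the collapse and the boxes contribute \<open>8 m\<close> each.\<close>

lemma no_injection_into_four_trees:
  fixes \<psi>\<^sub>1 :: "hpoint \<Rightarrow> 'a" and \<psi>\<^sub>2 :: "hpoint \<Rightarrow> 'b" and \<psi>\<^sub>3 :: "hpoint \<Rightarrow> 'c" and \<psi>\<^sub>4 :: "hpoint \<Rightarrow> 'd"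
    and \<kappa> :: "hpoint \<Rightarrow> nat"
  assumes trees: "tree F\<^sub>1" "tree F\<^sub>2" "tree F\<^sub>3" "tree F\<^sub>4"
    and growth: "\<And>r. 1 \<le> r \<Longrightarrow> growth F\<^sub>1 r \<le> enat (C * r)" "\<And>r. 1 \<le> r \<Longrightarrow> growth F\<^sub>2 r \<le> enat (C * r)"
      "\<And>r. 1 \<le> r \<Longrightarrow> growth F\<^sub>3 r \<le> enat (C * r)" "\<And>r. 1 \<le> r \<Longrightarrow> growth F\<^sub>4 r \<le> enat (C * r)"
    and V: "\<And>x. \<psi>\<^sub>1 x \<in> vertices F\<^sub>1" "\<And>x. \<psi>\<^sub>2 x \<in> vertices F\<^sub>2" "\<And>x. \<psi>\<^sub>3 x \<in> vertices F\<^sub>3"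
      "\<And>x. \<psi>\<^sub>4 x \<in> vertices F\<^sub>4" "\<And>x. \<kappa> x < C"
    and adj: "\<And>x s. s \<in> heisenberg_gens \<Longrightarrow> \<psi>\<^sub>1 x = \<psi>\<^sub>1 (x \<odot> s) \<or> adjacent F\<^sub>1 (\<psi>\<^sub>1 x) (\<psi>\<^sub>1 (x \<odot> s))"
      "\<And>x s. s \<in> heisenberg_gens \<Longrightarrow> \<psi>\<^sub>2 x = \<psi>\<^sub>2 (x \<odot> s) \<or> adjacent F\<^sub>2 (\<psi>\<^sub>2 x) (\<psi>\<^sub>2 (x \<odot> s))"
      "\<And>x s. s \<in> heisenberg_gens \<Longrightarrow> \<psi>\<^sub>3 x = \<psi>\<^sub>3 (x \<odot> s) \<or> adjacent F\<^sub>3 (\<psi>\<^sub>3 x) (\<psi>\<^sub>3 (x \<odot> s))"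
      "\<And>x s. s \<in> heisenberg_gens \<Longrightarrow> \<psi>\<^sub>4 x = \<psi>\<^sub>4 (x \<odot> s) \<or> adjacent F\<^sub>4 (\<psi>\<^sub>4 x) (\<psi>\<^sub>4 (x \<odot> s))"
  shows "\<not> inj (\<lambda>x. (\<psi>\<^sub>1 x, \<psi>\<^sub>2 x, \<psi>\<^sub>3 x, \<psi>\<^sub>4 x, \<kappa> x))"
proof
  let ?\<Phi> = "\<lambda>x. (\<psi>\<^sub>1 x, \<psi>\<^sub>2 x, \<psi>\<^sub>3 x, \<psi>\<^sub>4 x, \<kappa> x)"
  assume inj: "inj ?\<Phi>"
  define d where "d i = [\<lambda>x y. real (tdist F\<^sub>1 (\<psi>\<^sub>1 x) (\<psi>\<^sub>1 y)) / 8, \<lambda>x y. real (tdist F\<^sub>2 (\<psi>\<^sub>2 x) (\<psi>\<^sub>2 y)) / 8,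
    \<lambda>x y. real (tdist F\<^sub>3 (\<psi>\<^sub>3 x) (\<psi>\<^sub>3 y)) / 8, \<lambda>x y. real (tdist F\<^sub>4 (\<psi>\<^sub>4 x) (\<psi>\<^sub>4 y)) / 8] ! i" for i
  have hyp: "hyperbolic_lipschitz (d i)" if "i \<in> {..<4}" for i
  proof -
    have "i = 0 \<or> i = 1 \<or> i = 2 \<or> i = 3" using that by auto
    then show ?thesis
      using lipschitz_to_tree[where \<psi> = \<psi>\<^sub>1, OF trees(1) V(1) adj(1)]
        lipschitz_to_tree[where \<psi> = \<psi>\<^sub>2, OF trees(2) V(2) adj(2)]
        lipschitz_to_tree[where \<psi> = \<psi>\<^sub>3, OF trees(3) V(3) adj(3)]
        lipschitz_to_tree[where \<psi> = \<psi>\<^sub>4, OF trees(4) V(4) adj(4)]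
      by (elim disjE) (simp_all add: d_def)
  qed
  define J where "J = 16 ^ 4 * C ^ 5 + 1"
  obtain x m where m: "1 \<le> m"
    and col: "\<And>i j. \<lbrakk>i \<in> {..<4}; j \<le> J\<rbrakk> \<Longrightarrow> d i x (x \<odot> (0, 0, 2 * int m ^ 2 * int j)) \<le> real m"
  proof -
    have "\<exists>x m. 1 \<le> m \<and> (\<forall>i \<in> {..<4}. \<forall>j \<le> J. d i x (x \<odot> (0, 0, 2 * int m ^ 2 * int j)) \<le> real m)"
      by (rule collapsing_scale[OF finite_lessThan]) (auto simp: J_def intro: hyp)
    then show ?thesis by (elim exE conjE) (rule that, blast+)
  qed
  define S where "S = (\<lambda>(p, q, r, j). x \<odot> (0, 0, 2 * int m ^ 2 * int j) \<odot> (int p, int q, int r))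
    ` ({..<m} \<times> {..<m} \<times> {..<m ^ 2} \<times> {..<J})"
  have close: "d i x y \<le> 2 * real m" if i: "i \<in> {..<4}" and y: "y \<in> S" for i y
  proof -
    interpret hyperbolic_lipschitz "d i" by (rule hyp[OF i])
    obtain p q r j where y: "y = x \<odot> (0, 0, 2 * int m ^ 2 * int j) \<odot> (int p, int q, int r)"
      and pqr: "p < m" "q < m" "r < m ^ 2" and j: "j < J"
      using y unfolding S_def by auto
    have "int r \<le> int (m ^ 2)" using pqr(3) by (simp only: of_nat_le_iff less_imp_le)
    then have "(int p, int q, int r) \<in> box m" using pqr by (simp add: box_def)
    then have "d i (x \<odot> (0, 0, 2 * int m ^ 2 * int j)) y \<le> real m" unfolding y by (rule d_box)
    then show ?thesis
      using col[OF i, of j] j d_tri[of x y "x \<odot> (0, 0, 2 * int m ^ 2 * int j)"] by simp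
  qed
  let ?B1 = "{w \<in> vertices F\<^sub>1. tdist F\<^sub>1 (\<psi>\<^sub>1 x) w \<le> 16 * m}"
  let ?B2 = "{w \<in> vertices F\<^sub>2. tdist F\<^sub>2 (\<psi>\<^sub>2 x) w \<le> 16 * m}"
  let ?B3 = "{w \<in> vertices F\<^sub>3. tdist F\<^sub>3 (\<psi>\<^sub>3 x) w \<le> 16 * m}"
  let ?B4 = "{w \<in> vertices F\<^sub>4. tdist F\<^sub>4 (\<psi>\<^sub>4 x) w \<le> 16 * m}"
  have m16: "1 \<le> 16 * m" using m by simp
  note B = tree_ball_bound[OF trees(1) V(1) growth(1)[OF m16]] tree_ball_bound[OF trees(2) V(2) growth(2)[OF m16]]
    tree_ball_bound[OF trees(3) V(3) growth(3)[OF m16]] tree_ball_bound[OF trees(4) V(4) growth(4)[OF m16]]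
  have "?\<Phi> ` S \<subseteq> ?B1 \<times> ?B2 \<times> ?B3 \<times> ?B4 \<times> {..<C}"
  proof (rule image_subsetI)
    fix y assume "y \<in> S"
    from close[OF _ this, of 0] close[OF _ this, of 1] close[OF _ this, of 2] close[OF _ this, of 3]
    show "?\<Phi> y \<in> ?B1 \<times> ?B2 \<times> ?B3 \<times> ?B4 \<times> {..<C}"
      using V by (simp add: d_def)
  qed
  then have "card (?\<Phi> ` S) \<le> card (?B1 \<times> ?B2 \<times> ?B3 \<times> ?B4 \<times> {..<C})"
    using B by (intro card_mono finite_cartesian_product) auto
  also have "\<dots> = card ?B1 * (card ?B2 * (card ?B3 * (card ?B4 * C)))"
    by (simp add: card_cartesian_product)
  also have "\<dots> \<le> (C * (16 * m)) * ((C * (16 * m)) * ((C * (16 * m)) * ((C * (16 * m)) * C)))"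
    using B by (intro mult_le_mono) auto
  also have "\<dots> = m ^ 4 * (16 ^ 4 * C ^ 5)"
    by algebra
  also have "\<dots> < m ^ 4 * J" using m by (simp add: J_def)
  also have "m ^ 4 * J = card S"
    unfolding S_def by (rule card_column[OF m, symmetric])
  also have "\<dots> = card (?\<Phi> ` S)"
    by (rule card_image[symmetric], rule inj_on_subset[OF inj]) simp
  finally show False by simp
qed

theorem theorem1p2:
  shows "let G = cayley_graph heisenberg heisenberg_gens in
    (\<forall>r::nat. 1 \<le> r \<longrightarrow> growth G r \<le> enat (27 * r ^ 4)) \<and>
    (\<forall>(C::nat) (F1 :: 'a graph) (F2 :: 'b graph) (F3 :: 'c graph) (F4 :: 'd graph).
      1 \<le> C \<longrightarrow>
      tree F1 \<and> countable (vertices F1) \<and> (\<forall>r::nat. 1 \<le> r \<longrightarrow> growth F1 r \<le> enat (C * r)) \<longrightarrow>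
      tree F2 \<and> countable (vertices F2) \<and> (\<forall>r::nat. 1 \<le> r \<longrightarrow> growth F2 r \<le> enat (C * r)) \<longrightarrow>
      tree F3 \<and> countable (vertices F3) \<and> (\<forall>r::nat. 1 \<le> r \<longrightarrow> growth F3 r \<le> enat (C * r)) \<longrightarrow>
      tree F4 \<and> countable (vertices F4) \<and> (\<forall>r::nat. 1 \<le> r \<longrightarrow> growth F4 r \<le> enat (C * r)) \<longrightarrow>
      \<not> (\<exists>H. subgraph H (F1 \<times>\<^sub>s F2 \<times>\<^sub>s F3 \<times>\<^sub>s F4 \<times>\<^sub>s complete_graph C) \<and> isomorphic_graphs H G))"
  unfolding Let_def
proof (intro conjI allI impI notI)
  show "growth (cayley_graph heisenberg heisenberg_gens) r \<le> enat (27 * r ^ 4)" if "1 \<le> r" for r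
    by (rule heisenberg_growth[OF that])
next
  fix C and F1 :: "'a graph" and F2 :: "'b graph" and F3 :: "'c graph" and F4 :: "'d graph"
  let ?G = "cayley_graph heisenberg heisenberg_gens"
  let ?P = "F1 \<times>\<^sub>s F2 \<times>\<^sub>s F3 \<times>\<^sub>s F4 \<times>\<^sub>s complete_graph C"
  assume F: "tree F1 \<and> countable (vertices F1) \<and> (\<forall>r::nat. 1 \<le> r \<longrightarrow> growth F1 r \<le> enat (C * r))"
    "tree F2 \<and> countable (vertices F2) \<and> (\<forall>r::nat. 1 \<le> r \<longrightarrow> growth F2 r \<le> enat (C * r))"
    "tree F3 \<and> countable (vertices F3) \<and> (\<forall>r::nat. 1 \<le> r \<longrightarrow> growth F3 r \<le> enat (C * r))"
    "tree F4 \<and> countable (vertices F4) \<and> (\<forall>r::nat. 1 \<le> r \<longrightarrow> growth F4 r \<le> enat (C * r))"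
  assume "\<exists>H. subgraph H ?P \<and> isomorphic_graphs H ?G"
  then obtain H f where H: "subgraph H ?P" and f: "bij_betw f (vertices H) UNIV"
    and iso: "\<forall>u \<in> vertices H. \<forall>v \<in> vertices H. adjacent H u v \<longleftrightarrow> adjacent ?G (f u) (f v)"
    unfolding isomorphic_graphs_def by (auto simp: cayley_graph_def carrier_heisenberg)
  define \<phi> where "\<phi> = inv_into (vertices H) f"
  have \<phi>: "bij_betw \<phi> UNIV (vertices H)" unfolding \<phi>_def by (rule bij_betw_inv_into[OF f])
  have \<phi>V: "\<phi> x \<in> vertices H" for x using \<phi> by (auto simp: bij_betw_def)
  have vert: "\<phi> x \<in> vertices ?P" for x using H \<phi>V[of x] by (auto simp: subgraph_def)
  have adjP: "adjacent ?P (\<phi> x) (\<phi> (x \<odot> s))" if "s \<in> heisenberg_gens" for x s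
  proof (rule subgraph_adjacent[OF H])
    obtain a b c where x: "x = (a, b, c)" by (cases x)
    have "adjacent ?G x (x \<odot> s)"
      unfolding x adjacent_heisenberg using that by (auto simp: heisenberg_gens_def mult_heisenberg)
    moreover have "f (\<phi> y) = y" for y
      unfolding \<phi>_def using f by (simp add: bij_betw_inv_into_right)
    ultimately show "adjacent H (\<phi> x) (\<phi> (x \<odot> s))" using iso \<phi>V by simp
  qed
  have coords: "fst (fst (fst (fst (\<phi> x)))) \<in> vertices F1" "snd (fst (fst (fst (\<phi> x)))) \<in> vertices F2"
    "snd (fst (fst (\<phi> x))) \<in> vertices F3" "snd (fst (\<phi> x)) \<in> vertices F4" "snd (\<phi> x) < C" for x
    using vert[of x] by (auto simp: strong_product_def complete_graph_def)
  have steps: "fst (fst (fst (fst (\<phi> x)))) = fst (fst (fst (fst (\<phi> (x \<odot> s))))) \<or>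
      adjacent F1 (fst (fst (fst (fst (\<phi> x))))) (fst (fst (fst (fst (\<phi> (x \<odot> s))))))"
    "snd (fst (fst (fst (\<phi> x)))) = snd (fst (fst (fst (\<phi> (x \<odot> s))))) \<or>
      adjacent F2 (snd (fst (fst (fst (\<phi> x))))) (snd (fst (fst (fst (\<phi> (x \<odot> s))))))"
    "snd (fst (fst (\<phi> x))) = snd (fst (fst (\<phi> (x \<odot> s)))) \<or>
      adjacent F3 (snd (fst (fst (\<phi> x)))) (snd (fst (fst (\<phi> (x \<odot> s)))))"
    "snd (fst (\<phi> x)) = snd (fst (\<phi> (x \<odot> s))) \<or>
      adjacent F4 (snd (fst (\<phi> x))) (snd (fst (\<phi> (x \<odot> s))))"
    if "s \<in> heisenberg_gens" for x s
  proof -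
    note 4 = strong_product_step(1)[OF disjI2[OF adjP[OF that, of x]]]
    note 3 = strong_product_step[OF 4]
    note 2 = strong_product_step[OF 3(1)]
    note 1 = strong_product_step[OF 2(1)]
    show "fst (fst (fst (fst (\<phi> x)))) = fst (fst (fst (fst (\<phi> (x \<odot> s))))) \<or>
      adjacent F1 (fst (fst (fst (fst (\<phi> x))))) (fst (fst (fst (fst (\<phi> (x \<odot> s))))))" by (rule 1(1))
    show "snd (fst (fst (fst (\<phi> x)))) = snd (fst (fst (fst (\<phi> (x \<odot> s))))) \<or>
      adjacent F2 (snd (fst (fst (fst (\<phi> x))))) (snd (fst (fst (fst (\<phi> (x \<odot> s))))))" by (rule 1(2))
    show "snd (fst (fst (\<phi> x))) = snd (fst (fst (\<phi> (x \<odot> s)))) \<or>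
      adjacent F3 (snd (fst (fst (\<phi> x)))) (snd (fst (fst (\<phi> (x \<odot> s)))))" by (rule 2(2))
    show "snd (fst (\<phi> x)) = snd (fst (\<phi> (x \<odot> s))) \<or>
      adjacent F4 (snd (fst (\<phi> x))) (snd (fst (\<phi> (x \<odot> s))))" by (rule 3(2))
  qed
  have "\<not> inj (\<lambda>x. (fst (fst (fst (fst (\<phi> x)))), snd (fst (fst (fst (\<phi> x)))), snd (fst (fst (\<phi> x))),
      snd (fst (\<phi> x)), snd (\<phi> x)))"
    using F coords steps by (intro no_injection_into_four_trees[of F1 F2 F3 F4 C]) auto
  moreover have "inj (\<lambda>x. (fst (fst (fst (fst (\<phi> x)))), snd (fst (fst (fst (\<phi> x)))), snd (fst (fst (\<phi> x))),
      snd (fst (\<phi> x)), snd (\<phi> x)))"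
    using \<phi> by (auto simp: bij_betw_def inj_def prod_eq_iff)
  ultimately show False by contradiction
qed

end
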